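(* Let $\phi : X \to Y$ be a factor code between sofic shifts. Then the set $\mathcal{S}(\phi)$ is dense in the interval $[h(Y),h(X)]$. If $X$ is of finite type, then the set $\mathcal{S}_0(\phi)$ is also dense in $[h(Y),h(X)]$.
   Context: A shift space (subshift) is a closed shift-invariant subset of a full shift $\mathcal{A}^{\mathbb{Z}}$ over a finite alphabet $\mathcal{A}$, with shift map $\sigma$; shift spaces are nonempty. $\mathcal{B}_n(X)$ is the set of words of length $n$ appearing in points of $X$. The entropy of $X$ is $h(X)=\lim_{n\to\infty}\frac1n\log|\mathcal{B}_n(X)|$. A code is a continuous map between shift spaces commuting with the shift maps; a factor code is a surjective code. A shift of finite type is a shift space that can be defined by forbidding a finite set of words. A sofic shift is a shift space that is the image of a shift of finite type under a factor code. For a factor code $\phi:X\to Y$ between shift spaces define $$\mathcal{S}(\phi)=\{h(\phi_1(X)) : \phi=\phi_2\circ\phi_1 \text{ with } \phi_1 \text{ and } \phi_2 \text{ factor codes}\},$$ $$\mathcal{S}_0(\phi)=\{h(\phi_1(X)) : \phi=\phi_2\circ\phi_1 \text{ with } \phi_1 \text{ and } \phi_2 \text{ factor codes and } \phi_1(X) \text{ of finite type}\},$$ where $\phi_1$ is a factor code from $X$ onto a shift space $\phi_1(X)$ and $\phi_2$ is a factor code from $\phi_1(X)$ onto $Y$. *)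

theory Defs
  imports "HOL-Analysis.Analysis"
begin

text \<open>Alphabets are finite sets of letters in an arbitrary type. The product topology below is taken
  over the whole letter type; on the full shift over a finite alphabet \<open>A\<close> it induces the product of
  the discrete topologies on \<open>A\<close>, so the topology on a shift space does not depend on the
  alphabet it is considered over.\<close>

definition seq_topology :: "(int \<Rightarrow> 'a) topology" where
  "seq_topology = product_topology (\<lambda>_. discrete_topology UNIV) UNIV"

definition full_shift :: "'a set \<Rightarrow> (int \<Rightarrow> 'a) set" where
  "full_shift A = {x. \<forall>i. x i \<in> A}"

definition shift :: "(int \<Rightarrow> 'a) \<Rightarrow> (int \<Rightarrow> 'a)" where
  "shift x = (\<lambda>i. x (i + 1))"

definition shift_space :: "(int \<Rightarrow> 'a) set \<Rightarrow> bool" where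
  "shift_space X \<longleftrightarrow> X \<noteq> {} \<and> shift ` X = X \<and>
     (\<exists>A. finite A \<and> closedin (subtopology seq_topology (full_shift A)) X)"

definition occurs :: "'a list \<Rightarrow> (int \<Rightarrow> 'a) \<Rightarrow> bool" where
  "occurs w x \<longleftrightarrow> (\<exists>i. \<forall>k<length w. w ! k = x (i + int k))"

definition words :: "nat \<Rightarrow> (int \<Rightarrow> 'a) set \<Rightarrow> 'a list set" where
  "words n X = {w. length w = n \<and> (\<exists>x\<in>X. occurs w x)}"

definition entropy :: "(int \<Rightarrow> 'a) set \<Rightarrow> real" where
  "entropy X = lim (\<lambda>n. (1 / real n) * ln (real (card (words n X))))"

text \<open>A code from \<open>X\<close> to \<open>Y\<close> is a total function of which only the values on \<open>X\<close> matter.\<close>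

definition code :: "(int \<Rightarrow> 'a) set \<Rightarrow> (int \<Rightarrow> 'b) set \<Rightarrow> ((int \<Rightarrow> 'a) \<Rightarrow> (int \<Rightarrow> 'b)) \<Rightarrow> bool" where
  "code X Y \<phi> \<longleftrightarrow> shift_space X \<and> shift_space Y \<and>
     continuous_map (subtopology seq_topology X) (subtopology seq_topology Y) \<phi> \<and>
     (\<forall>x\<in>X. \<phi> (shift x) = shift (\<phi> x))"

definition factor_code ::
  "(int \<Rightarrow> 'a) set \<Rightarrow> (int \<Rightarrow> 'b) set \<Rightarrow> ((int \<Rightarrow> 'a) \<Rightarrow> (int \<Rightarrow> 'b)) \<Rightarrow> bool" where
  "factor_code X Y \<phi> \<longleftrightarrow> code X Y \<phi> \<and> \<phi> ` X = Y"

definition finite_type :: "(int \<Rightarrow> 'a) set \<Rightarrow> bool" where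
  "finite_type X \<longleftrightarrow> shift_space X \<and>
     (\<exists>A F. finite A \<and> finite F \<and> F \<subseteq> lists A \<and>
        X = {x \<in> full_shift A. \<forall>w\<in>F. \<not> occurs w x})"

text \<open>A shift space over any finite alphabet can be relabelled as one over a finite set of natural
  numbers. Hence, where a definition quantifies over shift spaces with unspecified alphabet (the
  cover of a sofic shift, the intermediate factor in a decomposition), natural numbers are
  used as letters without loss of generality.\<close>

definition sofic :: "(int \<Rightarrow> 'a) set \<Rightarrow> bool" where
  "sofic X \<longleftrightarrow> shift_space X \<and>
     (\<exists>(W :: (int \<Rightarrow> nat) set) \<pi>. finite_type W \<and> factor_code W X \<pi>)"

definition decomposes ::
  "(int \<Rightarrow> 'a) set \<Rightarrow> (int \<Rightarrow> 'b) set \<Rightarrow> ((int \<Rightarrow> 'a) \<Rightarrow> (int \<Rightarrow> 'b)) \<Rightarrow>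
   ((int \<Rightarrow> 'a) \<Rightarrow> (int \<Rightarrow> nat)) \<Rightarrow> ((int \<Rightarrow> nat) \<Rightarrow> (int \<Rightarrow> 'b)) \<Rightarrow> bool" where
  "decomposes X Y \<phi> \<phi>1 \<phi>2 \<longleftrightarrow>
     factor_code X (\<phi>1 ` X) \<phi>1 \<and> factor_code (\<phi>1 ` X) Y \<phi>2 \<and> (\<forall>x\<in>X. \<phi> x = \<phi>2 (\<phi>1 x))"

definition intermediate_entropies ::
  "(int \<Rightarrow> 'a) set \<Rightarrow> (int \<Rightarrow> 'b) set \<Rightarrow> ((int \<Rightarrow> 'a) \<Rightarrow> (int \<Rightarrow> 'b)) \<Rightarrow> real set" where
  "intermediate_entropies X Y \<phi> = {entropy (\<phi>1 ` X) |\<phi>1 \<phi>2. decomposes X Y \<phi> \<phi>1 \<phi>2}"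

definition intermediate_entropies_ft ::
  "(int \<Rightarrow> 'a) set \<Rightarrow> (int \<Rightarrow> 'b) set \<Rightarrow> ((int \<Rightarrow> 'a) \<Rightarrow> (int \<Rightarrow> 'b)) \<Rightarrow> real set" where
  "intermediate_entropies_ft X Y \<phi> =
     {entropy (\<phi>1 ` X) |\<phi>1 \<phi>2. decomposes X Y \<phi> \<phi>1 \<phi>2 \<and> finite_type (\<phi>1 ` X)}"

definition dense_subset :: "real set \<Rightarrow> real set \<Rightarrow> bool" where
  "dense_subset S T \<longleftrightarrow> S \<subseteq> T \<and> T \<subseteq> closure S"

end

(*
  Between X and Y one interpolates by revealing, besides \<phi>(x), the occurrences in x of words of
  a fixed large length n. Occurrences of a single word inside a block of length n/2 form an
  arithmetic progression, so revealing one more word raises the entropy by O(log n / n). Revealing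
  no word gives Y and revealing all words gives X, hence the entropies on the way are dense.

  For X of finite type it remains to insert, between X and any factor \<phi>(X), a shift of finite
  type Z with h(Z) close to h(\<phi>(X)). Present X as a vertex shift with labels y = \<phi>(x). Krieger
  markers on y, spaced by at least n, cover all positions except stretches on which y has a period
  p < n. The points of Z record y, the vertex at each marker, and, inside a periodic stretch, the
  class of the vertex under mutual reachability by paths labelled by m periods. Here m is chosen such
  that the m-th power of every relation on the vertices is idempotent. Two partial preimages can
  then be glued at a marker, or across m periods whose two ends have the same class; therefore
  membership in Z is decided by windows of bounded length. A vertex recorded every n steps costs
  entropy O(1/n), and within a periodic stretch the recorded class changes only boundedly often.
*)
theory Submission
  imports Defs "HOL-Real_Asymp.Real_Asymp"
begin

subsection \<open>Shift spaces and local maps\<close>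

text \<open>The symbol recorded on a periodic stretch serves two opposed purposes. It must be
  coarse: over a periodic label sequence the vertices themselves may carry positive entropy, so only
  something that changes boundedly often can be stored. It must be fine enough for gluing: without
  any record, whether the vertices at two consecutive markers can be joined could depend on the
  whole length of the stretch between them, which no bounded window sees. Classes of mutual
  reachability do both. A walk that meets a vertex again at the same phase has stayed in one class
  at that phase in between, so changes are few; and a walk can be led over into another walk of the
  same class. The obstacle is that the new walk must show the prescribed classes at every position,
  also during the transition. Hence the transition is placed where the old walk can return to its
  starting vertex: then old and new vertices lie on common closed walks. Idempotence compresses all
  these closed walks to \<open>m\<close> periods, so lengths never need adjusting.\<close>

definition win :: "(int \<Rightarrow> 'a) \<Rightarrow> int \<Rightarrow> nat \<Rightarrow> 'a list" where
  "win x i n = map (\<lambda>k. x (i + int k)) [0..<n]"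

definition translate :: "int \<Rightarrow> (int \<Rightarrow> 'a) \<Rightarrow> int \<Rightarrow> 'a" where
  "translate k x = (\<lambda>i. x (i + k))"

text \<open>Sliding block codes of radius \<open>r\<close>. Commuting with all integer translations
  lets the rule at coordinate 0 govern every coordinate; as for codes, values outside
  \<open>X\<close> do not matter.\<close>

definition local_code :: "(int \<Rightarrow> 'a) set \<Rightarrow> nat \<Rightarrow> ((int \<Rightarrow> 'a) \<Rightarrow> int \<Rightarrow> 'b) \<Rightarrow> bool" where
  "local_code X r f \<longleftrightarrow> (\<forall>x\<in>X. \<forall>k. f (translate k x) = translate k (f x)) \<and>
     (\<forall>x\<in>X. \<forall>x'\<in>X. (\<forall>j. \<bar>j\<bar> \<le> int r \<longrightarrow> x j = x' j) \<longrightarrow> f x 0 = f x' 0)"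

definition window_closed :: "(int \<Rightarrow> 'a) set \<Rightarrow> bool" where
  "window_closed X \<longleftrightarrow> (\<forall>x. (\<forall>n. \<exists>x'\<in>X. \<forall>j. \<bar>j\<bar> \<le> int n \<longrightarrow> x' j = x j) \<longrightarrow> x \<in> X)"

lemma length_win [simp]: "length (win x i n) = n"
  by (simp add: win_def)

lemma nth_win [simp]: "k < n \<Longrightarrow> win x i n ! k = x (i + int k)"
  by (simp add: win_def)

lemma win_eq_iff: "win x i n = win x' i' n \<longleftrightarrow> (\<forall>k<n. x (i + int k) = x' (i' + int k))"
  by (auto simp: list_eq_iff_nth_eq)

lemma win_eqI: "(\<And>j. i \<le> j \<Longrightarrow> j < i + int n \<Longrightarrow> x j = x' j) \<Longrightarrow> win x i n = win x' i n"
  by (auto simp: win_eq_iff)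

lemma win_eqD: "win x i n = win x' i n \<Longrightarrow> i \<le> j \<Longrightarrow> j < i + int n \<Longrightarrow> x j = x' j"
  by (auto simp: win_eq_iff dest: spec[of _ "nat (j - i)"])

lemma win_translate [simp]: "win (translate k x) i n = win x (i + k) n"
  by (simp add: win_def translate_def algebra_simps)

lemma translate_translate [simp]: "translate k (translate l x) = translate (k + l) x"
  by (simp add: translate_def algebra_simps)

lemma translate_0 [simp]: "translate 0 x = x"
  by (simp add: translate_def)

lemma translate_apply: "translate k x i = x (i + k)"
  by (simp add: translate_def)

lemma shift_eq_translate: "shift x = translate 1 x"
  by (simp add: shift_def translate_def)

lemma win_append: "win x i (m + n) = win x i m @ win x (i + int m) n"
  by (auto simp: list_eq_iff_nth_eq nth_append)

text \<open>Negative translations come from surjectivity: each point of \<open>X\<close> is the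
  shift of a point of \<open>X\<close>.\<close>

lemma translate_closed_iff:
  "shift ` X = X \<longleftrightarrow> (\<forall>x\<in>X. \<forall>k. translate k x \<in> X)"
proof
  assume X: "shift ` X = X"
  have pos: "translate (int n) x \<in> X" if "x \<in> X" for x n
  proof (induction n)
    case (Suc n)
    have "shift (translate (int n) x) \<in> X" using Suc X by blast
    then show ?case by (simp add: shift_eq_translate)
  qed (simp add: that)
  have neg: "translate (- int n) x \<in> X" if "x \<in> X" for x n
  proof (induction n)
    case (Suc n)
    obtain z where z: "z \<in> X" "translate (- int n) x = shift z" using Suc X by blast
    then have "translate (-1) (translate (- int n) x) = z" by (simp add: shift_eq_translate)
    then have "translate (- 1 - int n) x = z" by simp
    then show ?case using z by (simp add: algebra_simps)
  qed (simp add: that)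
  show "\<forall>x\<in>X. \<forall>k. translate k x \<in> X"
  proof (intro ballI allI)
    fix x k assume "x \<in> X"
    then show "translate k x \<in> X"
      using pos[of x "nat k"] neg[of x "nat (- k)"] by (cases "k \<ge> 0") auto
  qed
next
  assume X: "\<forall>x\<in>X. \<forall>k. translate k x \<in> X"
  have "x \<in> shift ` X" if "x \<in> X" for x
    using X that by (intro image_eqI[of _ _ "translate (-1) x"]) (auto simp: shift_eq_translate)
  then show "shift ` X = X" using X by (auto simp: shift_eq_translate)
qed

lemma commutes_translate:
  assumes "shift ` X = X" and c: "\<And>x. x \<in> X \<Longrightarrow> f (shift x) = shift (f x)" and "x \<in> X"
  shows "f (translate k x) = translate k (f x)"
proof -
  have T: "\<And>x k. x \<in> X \<Longrightarrow> translate k x \<in> X" using assms(1) translate_closed_iff by blast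
  have pos: "f (translate (int n) x) = translate (int n) (f x)" if "x \<in> X" for x n
  proof (induction n)
    case (Suc n)
    have "f (shift (translate (int n) x)) = shift (f (translate (int n) x))" using c T that by blast
    then show ?case using Suc by (simp add: shift_eq_translate)
  qed simp
  show ?thesis
  proof (cases "k \<ge> 0")
    case True
    then show ?thesis using pos[OF assms(3), of "nat k"] by simp
  next
    case False
    have "f (translate (int (nat (-k))) (translate k x)) = translate (int (nat (-k))) (f (translate k x))"
      using pos T assms(3) by blast
    then have "f x = translate (- k) (f (translate k x))" using False by simp
    then have "translate k (f x) = translate k (translate (- k) (f (translate k x)))" by simp
    then show ?thesis by simp
  qed
qed

section \<open>Topology of the sequence space in terms of central windows\<close>

lemma openin_seq_topology:
  "openin seq_topology U \<longleftrightarrow> (\<forall>x\<in>U. \<exists>n. \<forall>x'. (\<forall>j. \<bar>j\<bar> \<le> int n \<longrightarrow> x' j = x j) \<longrightarrow> x' \<in> U)"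
proof
  assume U: "openin seq_topology U"
  show "\<forall>x\<in>U. \<exists>n. \<forall>x'. (\<forall>j. \<bar>j\<bar> \<le> int n \<longrightarrow> x' j = x j) \<longrightarrow> x' \<in> U"
  proof
    fix x assume "x \<in> U"
    with U obtain W where W: "finite {i. W i \<noteq> UNIV}" "x \<in> Pi\<^sub>E UNIV W" "Pi\<^sub>E UNIV W \<subseteq> U"
      by (auto simp: seq_topology_def openin_product_topology_alt)
    obtain n where n: "\<And>j. j \<in> {i. W i \<noteq> UNIV} \<Longrightarrow> \<bar>j\<bar> \<le> n"
      using W(1) by (metis abs_ge_self finite_nat_set_iff_bounded_le finite_imageI Max_ge imageI)
    have "x' \<in> U" if x': "\<forall>j. \<bar>j\<bar> \<le> int (nat n) \<longrightarrow> x' j = x j" for x'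
    proof -
      have "x' j \<in> W j" for j
      proof (cases "W j = UNIV")
        case False
        then have "\<bar>j\<bar> \<le> int (nat n)" using n[of j] by auto
        then have "x' j = x j" using x' by blast
        then show ?thesis using W(2) by (simp add: PiE_iff)
      qed simp
      then show ?thesis using W(3) by (auto simp: PiE_iff)
    qed
    then show "\<exists>n. \<forall>x'. (\<forall>j. \<bar>j\<bar> \<le> int n \<longrightarrow> x' j = x j) \<longrightarrow> x' \<in> U" by blast
  qed
next
  assume H: "\<forall>x\<in>U. \<exists>n. \<forall>x'. (\<forall>j. \<bar>j\<bar> \<le> int n \<longrightarrow> x' j = x j) \<longrightarrow> x' \<in> U"
  show "openin seq_topology U"
    unfolding seq_topology_def openin_product_topology_alt
  proof (intro ballI)
    fix x assume "x \<in> U"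
    then obtain n where n: "\<And>x'. (\<forall>j. \<bar>j\<bar> \<le> int n \<longrightarrow> x' j = x j) \<Longrightarrow> x' \<in> U" using H by blast
    let ?W = "\<lambda>j. if \<bar>j\<bar> \<le> int n then {x j} else UNIV"
    have "{i. ?W i \<noteq> UNIV} \<subseteq> {- int n..int n}" by auto
    then have "finite {i. ?W i \<noteq> UNIV}" using finite_subset by blast
    moreover have "x \<in> Pi\<^sub>E UNIV ?W" by (auto simp: PiE_iff)
    moreover have "Pi\<^sub>E UNIV ?W \<subseteq> U"
      using n by (auto simp: PiE_iff split: if_splits)
    ultimately show "\<exists>Ua. finite {i \<in> UNIV. Ua i \<noteq> topspace (discrete_topology UNIV)} \<and>
        (\<forall>i\<in>UNIV. openin (discrete_topology UNIV) (Ua i)) \<and> x \<in> Pi\<^sub>E UNIV Ua \<and> Pi\<^sub>E UNIV Ua \<subseteq> U"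
      by (intro exI[of _ ?W]) auto
  qed
qed

lemma openin_seq_topologyE:
  assumes "openin seq_topology U" "x \<in> U"
  obtains n where "\<And>x'. (\<forall>j. \<bar>j\<bar> \<le> int n \<longrightarrow> x' j = x j) \<Longrightarrow> x' \<in> U"
proof -
  have "\<exists>n. \<forall>x'. (\<forall>j. \<bar>j\<bar> \<le> int n \<longrightarrow> x' j = x j) \<longrightarrow> x' \<in> U"
    using bspec[OF assms(1)[unfolded openin_seq_topology] assms(2)] .
  then show ?thesis by (elim exE) (rule that, blast)
qed

lemma topspace_seq_topology [simp]: "topspace seq_topology = UNIV"
  by (simp add: seq_topology_def)

lemma closedin_seq_topology: "closedin seq_topology X \<longleftrightarrow> window_closed X"
proof -
  have "closedin seq_topology X \<longleftrightarrow>
      (\<forall>x. x \<notin> X \<longrightarrow> (\<exists>n. \<forall>x'. (\<forall>j. \<bar>j\<bar> \<le> int n \<longrightarrow> x' j = x j) \<longrightarrow> x' \<notin> X))"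
    by (simp add: closedin_def openin_seq_topology Ball_def)
  also have "\<dots> \<longleftrightarrow> window_closed X"
    unfolding window_closed_def by blast
  finally show ?thesis .
qed

lemma window_closed_full_shift: "window_closed (full_shift A)"
proof -
  have "x i \<in> A" if x: "\<forall>n. \<exists>x'\<in>full_shift A. \<forall>j. \<bar>j\<bar> \<le> int n \<longrightarrow> x' j = x j" for x i
  proof -
    obtain x' where "x' \<in> full_shift A" "\<forall>j. \<bar>j\<bar> \<le> int (nat \<bar>i\<bar>) \<longrightarrow> x' j = x j"
      using spec[OF x, of "nat \<bar>i\<bar>"] by (elim bexE)
    then show ?thesis by (auto simp: full_shift_def dest!: spec[of _ i])
  qed
  then show ?thesis unfolding window_closed_def full_shift_def by blast
qed

text \<open>The full shift is itself closed, so closedness relative to it is closedness among all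
  sequences, and the alphabet only bounds the letters.\<close>

lemma shift_space_iff:
  "shift_space X \<longleftrightarrow> X \<noteq> {} \<and> (\<forall>x\<in>X. \<forall>k. translate k x \<in> X) \<and>
     (\<exists>A. finite A \<and> X \<subseteq> full_shift A) \<and> window_closed X"
proof -
  have "closedin (subtopology seq_topology (full_shift A)) X \<longleftrightarrow> X \<subseteq> full_shift A \<and> window_closed X" for A :: "'a set"
    using closedin_closed_subtopology[of seq_topology "full_shift A" X] window_closed_full_shift[of A]
    by (auto simp: closedin_seq_topology)
  then show ?thesis unfolding shift_space_def translate_closed_iff by blast
qed

lemma compactin_full_shift: "finite A \<Longrightarrow> compactin seq_topology (full_shift A)"
proof -
  assume "finite A"
  moreover have "full_shift A = Pi\<^sub>E UNIV (\<lambda>_. A)" by (auto simp: full_shift_def PiE_iff)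
  ultimately show ?thesis by (simp add: seq_topology_def compactin_PiE compactin_discrete_topology)
qed

lemma compactin_shift_space: "shift_space X \<Longrightarrow> compactin seq_topology X"
  by (meson closed_compactin closedin_seq_topology compactin_full_shift shift_space_iff)

lemma shift_spaceD:
  assumes "shift_space X"
  shows "X \<noteq> {}" "\<And>x k. x \<in> X \<Longrightarrow> translate k x \<in> X" "window_closed X"
  using assms by (auto simp: shift_space_iff)

lemma local_codeD:
  assumes "local_code X r f" "shift_space X" "x \<in> X" "x' \<in> X"
    and "\<And>j. \<bar>j - i\<bar> \<le> int r \<Longrightarrow> x j = x' j"
  shows "f x i = f x' i"
proof -
  have "translate i x \<in> X" "translate i x' \<in> X"
    using shift_spaceD(2)[OF assms(2)] assms(3,4) by auto
  moreover have "\<forall>j. \<bar>j\<bar> \<le> int r \<longrightarrow> translate i x j = translate i x' j"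
    by (auto intro!: assms(5) simp: translate_apply)
  ultimately have "f (translate i x) 0 = f (translate i x') 0"
    using assms(1) unfolding local_code_def by blast
  then show ?thesis using assms(1,3,4) by (simp add: local_code_def translate_apply)
qed

lemma local_code_translate: "local_code X r f \<Longrightarrow> x \<in> X \<Longrightarrow> f (translate k x) = translate k (f x)"
  by (simp add: local_code_def)

lemma continuous_local_code:
  assumes "local_code X r f" "shift_space X"
  shows "continuous_map (subtopology seq_topology X) seq_topology f"
proof -
  have "openin (subtopology seq_topology X) {x \<in> X. f x \<in> U}" if U: "openin seq_topology U" for U
  proof -
    \<comment> \<open>The union of all cylinders around points of \<open>X\<close> on whose trace in
      \<open>X\<close> the map takes values in \<open>U\<close>. Since \<open>f\<close> is
      controlled on \<open>X\<close> only, the preimage of \<open>U\<close> itself need not be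
      open.\<close>
    let ?W = "{x'. \<exists>x n. x \<in> X \<and> (\<forall>j. \<bar>j\<bar> \<le> int n \<longrightarrow> x' j = x j) \<and>
                (\<forall>z\<in>X. (\<forall>j. \<bar>j\<bar> \<le> int n \<longrightarrow> z j = x j) \<longrightarrow> f z \<in> U)}"
    have "openin seq_topology ?W" unfolding openin_seq_topology
    proof
      fix x' assume "x' \<in> ?W"
      then obtain x n where x: "x \<in> X" "\<forall>j. \<bar>j\<bar> \<le> int n \<longrightarrow> x' j = x j"
        "\<forall>z\<in>X. (\<forall>j. \<bar>j\<bar> \<le> int n \<longrightarrow> z j = x j) \<longrightarrow> f z \<in> U" by blast
      have "z \<in> ?W" if "\<forall>j. \<bar>j\<bar> \<le> int n \<longrightarrow> z j = x' j" for z
      proof -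
        have "\<forall>j. \<bar>j\<bar> \<le> int n \<longrightarrow> z j = x j" using that x(2) by simp
        then show ?thesis using x(1,3) by blast
      qed
      then show "\<exists>n. \<forall>z. (\<forall>j. \<bar>j\<bar> \<le> int n \<longrightarrow> z j = x' j) \<longrightarrow> z \<in> ?W" by blast
    qed
    moreover have "{x \<in> X. f x \<in> U} = ?W \<inter> X"
    proof (intro equalityI subsetI)
      fix x assume x: "x \<in> {x \<in> X. f x \<in> U}"
      then obtain n where n: "\<And>y. (\<forall>j. \<bar>j\<bar> \<le> int n \<longrightarrow> y j = f x j) \<Longrightarrow> y \<in> U"
        using openin_seq_topologyE[OF U, of "f x"] by auto
      have "f z \<in> U" if "z \<in> X" "\<forall>j. \<bar>j\<bar> \<le> int (n + r) \<longrightarrow> z j = x j" for z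
        by (intro n allI impI local_codeD[OF assms]) (use x that in auto)
      then show "x \<in> ?W \<inter> X" using x by blast
    qed auto
    ultimately show ?thesis by (auto simp: openin_subtopology)
  qed
  then show ?thesis by (auto simp: continuous_map_def)
qed

text \<open>A continuous image of a compact set is compact, hence closed in the Hausdorff space of
  all sequences.\<close>

lemma shift_space_image:
  assumes f: "local_code X r f" and X: "shift_space X"
    and A: "finite A" "\<And>x. x \<in> X \<Longrightarrow> f x 0 \<in> A"
  shows "shift_space (f ` X)"
proof -
  have "compactin seq_topology (f ` X)"
    using image_compactin[OF _ continuous_local_code[OF f X]] compactin_shift_space[OF X]
    by (simp add: compactin_subtopology)
  moreover have "Hausdorff_space (seq_topology :: (int \<Rightarrow> 'b) topology)"
    by (simp add: seq_topology_def Hausdorff_space_product_topology)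
  ultimately have "window_closed (f ` X)"
    using closedin_seq_topology compactin_imp_closedin by blast
  moreover have "f x i \<in> A" if "x \<in> X" for x i
    using A(2)[of "translate i x"] that shift_spaceD(2)[OF X] local_code_translate[OF f]
    by (auto simp: translate_apply)
  then have "f ` X \<subseteq> full_shift A" by (auto simp: full_shift_def)
  moreover have "translate k y \<in> f ` X" if "y \<in> f ` X" for k y
    using that shift_spaceD(2)[OF X] local_code_translate[OF f] by (metis imageE imageI)
  ultimately show ?thesis
    using shift_spaceD(1)[OF X] A(1) unfolding shift_space_iff by blast
qed

lemma factor_code_local:
  assumes f: "local_code X r f" and X: "shift_space X" and Y: "shift_space (f ` X)"
  shows "factor_code X (f ` X) f"
  unfolding factor_code_def code_def
  using X Y continuous_local_code[OF f X] local_code_translate[OF f]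
  by (auto simp: continuous_map_in_subtopology shift_eq_translate)

text \<open>Curtis-Hedlund-Lyndon: finitely many cylinders on which coordinate 0 of the image is
  constant cover \<open>X\<close>, and the largest of their radii serves all points.\<close>

lemma factor_code_imp_local:
  assumes "factor_code X Y f"
  obtains r where "local_code X r f"
proof -
  have X: "shift_space X" and cont: "continuous_map (subtopology seq_topology X) seq_topology f"
    and comm: "\<And>x. x \<in> X \<Longrightarrow> f (shift x) = shift (f x)"
    using assms by (auto simp: factor_code_def code_def continuous_map_in_subtopology)
  have "\<exists>n. \<forall>x'\<in>X. (\<forall>j. \<bar>j\<bar> \<le> int n \<longrightarrow> x' j = x j) \<longrightarrow> f x' 0 = f x 0" if x: "x \<in> X" for x
  proof -
    have "openin seq_topology {z. z 0 = f x 0}"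
      unfolding openin_seq_topology by (auto intro: exI[of _ 0])
    then have "openin (subtopology seq_topology X) {x' \<in> X. f x' 0 = f x 0}"
      using cont by (auto simp: continuous_map_def)
    then obtain U where U: "openin seq_topology U" "{x' \<in> X. f x' 0 = f x 0} = U \<inter> X"
      by (auto simp: openin_subtopology)
    then have "x \<in> U" using x by blast
    then obtain n where "\<And>x'. (\<forall>j. \<bar>j\<bar> \<le> int n \<longrightarrow> x' j = x j) \<Longrightarrow> x' \<in> U"
      using openin_seq_topologyE[OF U(1)] by blast
    then show ?thesis using U(2) by blast
  qed
  then obtain n where n: "\<And>x x'. x \<in> X \<Longrightarrow> x' \<in> X \<Longrightarrow> (\<forall>j. \<bar>j\<bar> \<le> int (n x) \<longrightarrow> x' j = x j) \<Longrightarrow> f x' 0 = f x 0"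
    by metis
  define C where "C x = {x'. \<forall>j. \<bar>j\<bar> \<le> int (n x) \<longrightarrow> x' j = x j}" for x
  have "openin seq_topology (C x)" for x
    unfolding openin_seq_topology C_def by (auto intro!: exI[of _ "n x"])
  moreover have "X \<subseteq> \<Union>(C ` X)" by (auto simp: C_def)
  ultimately obtain F where F: "finite F" "F \<subseteq> C ` X" "X \<subseteq> \<Union>F"
    using compactin_shift_space[OF X] unfolding compactin_def
    by (metis (no_types, lifting) imageE)
  obtain E where E: "finite E" "E \<subseteq> X" "F = C ` E"
    using finite_subset_image[OF F(1,2)] by blast
  obtain r where r: "\<And>x. x \<in> E \<Longrightarrow> n x \<le> r"
    using finite_imageI[OF E(1), of n] unfolding finite_nat_set_iff_bounded_le by blast
  have "f x 0 = f x' 0" if x: "x \<in> X" "x' \<in> X" "\<forall>j. \<bar>j\<bar> \<le> int r \<longrightarrow> x j = x' j" for x x'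
  proof -
    obtain e where e: "e \<in> E" "x \<in> C e" using E(3) F(3) x(1) by blast
    have "x' \<in> C e" unfolding C_def
    proof (intro CollectI allI impI)
      fix j assume j: "\<bar>j\<bar> \<le> int (n e)"
      then have "x j = x' j" using r[OF e(1)] x(3) by simp
      then show "x' j = e j" using e(2) j by (simp add: C_def)
    qed
    then have "f x 0 = f e 0" "f x' 0 = f e 0"
      using n[of e x] n[of e x'] e E(2) x(1,2) by (auto simp: C_def)
    then show ?thesis by simp
  qed
  moreover have "shift ` X = X" using X by (simp add: shift_space_def)
  then have "\<forall>x\<in>X. \<forall>k. f (translate k x) = translate k (f x)"
    using commutes_translate comm by blast
  ultimately have "local_code X r f" unfolding local_code_def by blast
  then show ?thesis using that by blast
qed

section \<open>Words, and finite type as a condition on windows\<close>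

lemma words_eq: "words n X = (\<Union>x\<in>X. range (\<lambda>i. win x i n))"
proof -
  have "w = win x i n \<longleftrightarrow> length w = n \<and> (\<forall>k<length w. w ! k = x (i + int k))" for w x i
    by (auto simp: list_eq_iff_nth_eq)
  then show ?thesis unfolding words_def occurs_def by blast
qed

lemma win_in_words: "x \<in> X \<Longrightarrow> win x i n \<in> words n X"
  by (auto simp: words_eq)

lemma words_eq_0: "shift_space X \<Longrightarrow> words n X = (\<lambda>x. win x i n) ` X"
proof -
  assume X: "shift_space X"
  have "win x j n \<in> (\<lambda>x. win x i n) ` X" if "x \<in> X" for x j
    using shift_spaceD(2)[OF X that, of "j - i"] by (intro image_eqI[of _ _ "translate (j - i) x"]) auto
  then show ?thesis by (auto simp: words_eq)
qed

lemma alphabet_obtain: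
  assumes "shift_space X"
  obtains A where "finite A" "\<And>x i. x \<in> X \<Longrightarrow> x i \<in> A"
  using assms unfolding shift_space_iff full_shift_def by blast

lemma words_subset_lists:
  assumes "\<And>x i. x \<in> X \<Longrightarrow> x i \<in> A"
  shows "words n X \<subseteq> {w. set w \<subseteq> A \<and> length w = n}"
  using assms by (auto simp: words_eq win_def)

lemma finite_words: "shift_space X \<Longrightarrow> finite (words n X)"
  by (metis alphabet_obtain words_subset_lists finite_lists_length_eq finite_subset)

lemma words_nonempty: "shift_space X \<Longrightarrow> words n X \<noteq> {}"
  by (simp add: words_eq_0[of _ _ 0] shift_spaceD(1))

lemma card_words_pos: "shift_space X \<Longrightarrow> card (words n X) > 0"
  using finite_words words_nonempty by (metis card_gt_0_iff)

text \<open>It suffices to forbid the words of length \<open>M\<close> over a finite alphabet that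
  do not occur in \<open>Z\<close>.\<close>

lemma finite_typeI:
  assumes Z: "shift_space Z" and M: "\<And>z. (\<And>i. win z i M \<in> words M Z) \<Longrightarrow> z \<in> Z"
  shows "finite_type Z"
proof -
  obtain A where A: "finite A" "\<And>x i. x \<in> Z \<Longrightarrow> x i \<in> A" using alphabet_obtain[OF Z] by blast
  define F where "F = {w. set w \<subseteq> A \<and> length w = M} - words M Z"
  have occ: "occurs w z \<longleftrightarrow> (\<exists>i. w = win z i (length w))" for w and z :: "int \<Rightarrow> 'a"
    by (auto simp: occurs_def list_eq_iff_nth_eq)
  have "Z = {x \<in> full_shift A. \<forall>w\<in>F. \<not> occurs w x}"
  proof (intro equalityI subsetI)
    fix x assume "x \<in> Z"
    then show "x \<in> {x \<in> full_shift A. \<forall>w\<in>F. \<not> occurs w x}"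
      using A(2) by (auto simp: full_shift_def F_def words_def)
  next
    fix x assume x: "x \<in> {x \<in> full_shift A. \<forall>w\<in>F. \<not> occurs w x}"
    show "x \<in> Z"
    proof (rule M, rule ccontr)
      fix i assume "win x i M \<notin> words M Z"
      then have "win x i M \<in> F" using x by (auto simp: F_def full_shift_def win_def)
      moreover have "occurs (win x i M) x" by (auto simp: occ)
      ultimately show False using x by blast
    qed
  qed
  moreover have "finite F" using A(1) by (simp add: F_def finite_lists_length_eq)
  moreover have "F \<subseteq> lists A" by (auto simp: F_def)
  ultimately show ?thesis unfolding finite_type_def using Z A(1) by blast
qed

lemma finite_typeE:
  assumes "finite_type X"
  obtains M where "\<And>N x. M \<le> N \<Longrightarrow> (\<And>i. win x i N \<in> words N X) \<Longrightarrow> x \<in> X"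
proof -
  obtain A F where AF: "finite A" "finite F" "X = {x \<in> full_shift A. \<forall>w\<in>F. \<not> occurs w x}"
    using assms by (auto simp: finite_type_def)
  obtain M0 where M0: "\<And>w. w \<in> F \<Longrightarrow> length w \<le> M0"
    using AF(2) by (metis finite_imageI finite_nat_set_iff_bounded_le imageI)
  \<comment> \<open>\<open>Suc M0\<close> rather than \<open>M0\<close>: windows must be nonempty,
    also when nothing is forbidden, so that they force the letters of \<open>x\<close> into
    \<open>A\<close>.\<close>
  have "x \<in> X" if N: "Suc M0 \<le> N" and w: "\<And>i. win x i N \<in> words N X" for N x
  proof -
    have *: "\<exists>x'\<in>X. \<exists>i'. \<forall>k<N. x (i + int k) = x' (i' + int k)" for i
    proof -
      obtain x' i' where "x' \<in> X" "win x i N = win x' i' N" using w[of i] by (auto simp: words_eq)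
      then show ?thesis by (auto simp: win_eq_iff)
    qed
    have "x i \<in> A" for i
    proof -
      obtain x' i' where "x' \<in> X" "x (i + int 0) = x' (i' + int 0)"
        using *[of i] N by (metis Suc_le_eq gr_zeroI not_less0)
      then show ?thesis using AF(3) by (auto simp: full_shift_def)
    qed
    moreover have "\<not> occurs v x" if v: "v \<in> F" for v
    proof
      assume "occurs v x"
      then obtain i where i: "\<And>k. k < length v \<Longrightarrow> v ! k = x (i + int k)" by (auto simp: occurs_def)
      obtain x' i' where x': "x' \<in> X" "\<forall>k<N. x (i + int k) = x' (i' + int k)" using * by blast
      have "occurs v x'" unfolding occurs_def using i x'(2) M0[OF v] N by (intro exI[of _ i']) auto
      then show False using x'(1) AF(3) v by blast
    qed
    ultimately show ?thesis using AF(3) by (auto simp: full_shift_def)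
  qed
  then show ?thesis using that by blast
qed

subsection \<open>Entropy\<close>

lemma subadditive_bound:
  fixes a :: "nat \<Rightarrow> real"
  assumes "\<And>m n. a (m + n) \<le> a m + a n"
  shows "a (q * k + r) \<le> real k * a q + a r"
proof (induction k)
  case (Suc k)
  have "a (q + (q * k + r)) \<le> a q + a (q * k + r)" by (rule assms)
  then show ?case using Suc by (simp add: algebra_simps)
qed simp

text \<open>Fekete's lemma. Division with remainder by a \<open>q\<close> for which
  \<open>a q / real q\<close> nearly attains the infimum bounds all large quotients.\<close>

lemma subadditive_convergent:
  fixes a :: "nat \<Rightarrow> real"
  assumes sub: "\<And>m n. a (m + n) \<le> a m + a n" and pos: "\<And>n. 0 \<le> a n"
  shows "convergent (\<lambda>n. a n / real n)"
proof -
  define L where "L = Inf ((\<lambda>n. a n / real n) ` {1..})"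
  have bdd: "bdd_below ((\<lambda>n. a n / real n) ` {1..})"
    using pos by (intro bdd_belowI2[of _ 0]) simp
  have low: "L \<le> a n / real n" if "n \<ge> 1" for n
    unfolding L_def using that by (intro cInf_lower bdd) auto
  have "(\<lambda>n. a n / real n) \<longlonglongrightarrow> L"
  proof (rule LIMSEQ_I)
    fix e :: real assume e: "e > 0"
    have "Inf ((\<lambda>n. a n / real n) ` {1..}) < L + e / 2" using e by (simp add: L_def)
    then obtain q where q: "q \<ge> 1" "a q / real q < L + e / 2"
      using cInf_less_iff[OF _ bdd] by auto
    \<comment> \<open>Bounds \<open>a (n mod q)\<close> for every \<open>n\<close>.\<close>
    define C where "C = (\<Sum>r<q. a r)"
    obtain N where N: "real N > 2 * C / e" using reals_Archimedean2 by blast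
    have "norm (a n / real n - L) < e" if n: "n \<ge> Suc N" for n
    proof -
      have n0: "real n > 0" using n by simp
      have "a n \<le> real (n div q) * a q + a (n mod q)"
        using subadditive_bound[OF sub, of q "n div q" "n mod q"] by simp
      also have "a (n mod q) \<le> C" unfolding C_def
        using q by (intro member_le_sum) (auto simp: pos)
      also have "real (n div q) * a q \<le> (real n / real q) * a q"
        by (intro mult_right_mono pos of_nat_div_le_of_nat)
      finally have "a n \<le> (real n / real q) * a q + C" by simp
      then have "a n / real n \<le> ((real n / real q) * a q + C) / real n"
        using n0 by (intro divide_right_mono) auto
      also have "\<dots> = a q / real q + C / real n"
        using n0 q by (simp add: field_simps)
      also have "C / real n < e / 2"
      proof -
        have "2 * C / e < real n" using N n by linarith
        then show ?thesis using e n0 by (simp add: field_simps)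
      qed
      finally have "a n / real n < L + e" using q(2) by simp
      then show ?thesis using low[of n] n by simp
    qed
    then show "\<exists>no. \<forall>n\<ge>no. norm (a n / real n - L) < e" by blast
  qed
  then show ?thesis by (auto simp: convergent_def)
qed

lemma card_words_add:
  assumes X: "shift_space X"
  shows "card (words (m + n) X) \<le> card (words m X) * card (words n X)"
proof -
  have "words (m + n) X \<subseteq> (\<lambda>(u, v). u @ v) ` (words m X \<times> words n X)"
    by (auto simp: words_eq win_append)
  then have "card (words (m + n) X) \<le> card (words m X \<times> words n X)"
    by (meson X card_image_le card_mono finite_SigmaI finite_imageI finite_words order_trans)
  then show ?thesis by (simp add: card_cartesian_product)
qed

lemma ln_card_words_nonneg: "shift_space X \<Longrightarrow> 0 \<le> ln (real (card (words n X)))"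
  using card_words_pos[of X n] by (simp add: Suc_leI)

lemma entropy_tendsto:
  assumes X: "shift_space X"
  shows "(\<lambda>n. ln (real (card (words n X))) / real n) \<longlonglongrightarrow> entropy X"
proof -
  have "ln (real (card (words (m + n) X))) \<le> ln (real (card (words m X))) + ln (real (card (words n X)))" for m n
  proof -
    have "ln (real (card (words (m + n) X))) \<le> ln (real (card (words m X)) * real (card (words n X)))"
      using card_words_add[OF X, of m n] card_words_pos[OF X]
      by (subst ln_le_cancel_iff) (auto simp flip: of_nat_mult)
    also have "\<dots> = ln (real (card (words m X))) + ln (real (card (words n X)))"
      using card_words_pos[OF X] by (subst ln_mult) auto
    finally show ?thesis .
  qed
  then have "convergent (\<lambda>n. ln (real (card (words n X))) / real n)"
    by (intro subadditive_convergent ln_card_words_nonneg[OF X])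
  then show ?thesis by (simp add: entropy_def convergent_LIMSEQ_iff)
qed

text \<open>Since the entropies are limits, it is enough to look at multiples of \<open>B\<close>.
  The surplus length \<open>c\<close> costs a constant factor, which disappears in the limit, and
  each block contributes a factor \<open>Q\<close>.\<close>

lemma entropy_compare:
  assumes Z1: "shift_space Z1" and Z0: "shift_space Z0" and B: "B \<ge> 1"
    and le: "\<And>k. card (words (k * B) Z1) \<le> card (words (k * B + c) Z0) * Q ^ k"
  shows "entropy Z1 \<le> entropy Z0 + ln (real Q) / real B"
proof -
  have Q: "Q > 0" using le[of 1] card_words_pos[OF Z1, of "1 * B"] by (cases "Q = 0") auto
  let ?f = "\<lambda>n. ln (real (card (words n Z1))) / real n"
  let ?g = "\<lambda>n. ln (real (card (words n Z0))) / real n"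
  let ?c = "ln (real (card (words c Z0)))"
  have sub: "strict_mono (\<lambda>k. k * B)" using B by (intro strict_monoI) auto
  have f: "(\<lambda>k. ?f (k * B)) \<longlonglongrightarrow> entropy Z1"
    using LIMSEQ_subseq_LIMSEQ[OF entropy_tendsto[OF Z1] sub] by (simp add: o_def)
  have g: "(\<lambda>k. ?g (k * B)) \<longlonglongrightarrow> entropy Z0"
    using LIMSEQ_subseq_LIMSEQ[OF entropy_tendsto[OF Z0] sub] by (simp add: o_def)
  have "(\<lambda>k. ?c / real k) \<longlonglongrightarrow> 0" by (rule lim_const_over_n)
  from LIMSEQ_subseq_LIMSEQ[OF this sub]
  have c: "(\<lambda>k. ?c / real (k * B)) \<longlonglongrightarrow> 0" by (simp add: o_def)
  have "(\<lambda>k. ?g (k * B) + ?c / real (k * B) + ln (real Q) / real B) \<longlonglongrightarrow> entropy Z0 + 0 + ln (real Q) / real B"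
    by (intro tendsto_intros g c)
  moreover have "?f (k * B) \<le> ?g (k * B) + ?c / real (k * B) + ln (real Q) / real B" if k: "k \<ge> 1" for k
  proof -
    have "card (words (k * B) Z1) \<le> card (words (k * B) Z0) * card (words c Z0) * Q ^ k"
      using le[of k] card_words_add[OF Z0, of "k * B" c] by (meson mult_le_mono1 order_trans)
    then have "real (card (words (k * B) Z1)) \<le> real (card (words (k * B) Z0)) * real (card (words c Z0)) * real Q ^ k"
      by (simp flip: of_nat_mult of_nat_power)
    then have "ln (real (card (words (k * B) Z1))) \<le> ln (real (card (words (k * B) Z0)) * real (card (words c Z0)) * real Q ^ k)"
      using card_words_pos[OF Z1] card_words_pos[OF Z0] Q by (subst ln_le_cancel_iff) auto
    also have "\<dots> = ln (real (card (words (k * B) Z0))) + ?c + real k * ln (real Q)"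
      using card_words_pos[OF Z0] Q by (simp add: ln_mult ln_realpow)
    finally have "?f (k * B) \<le> (ln (real (card (words (k * B) Z0))) + ?c + real k * ln (real Q)) / real (k * B)"
      by (intro divide_right_mono) auto
    also have "\<dots> = ?g (k * B) + ?c / real (k * B) + ln (real Q) / real B"
      using k B by (simp add: field_simps)
    finally show ?thesis .
  qed
  ultimately show ?thesis
    using LIMSEQ_le[OF f] by (metis (no_types, lifting) add.right_neutral)
qed

text \<open>The common tool of all entropy estimates: if \<open>f\<close>, known on a block of
  length \<open>B\<close> and on \<open>c\<close> further positions at either end, leaves at most
  \<open>Q\<close> possibilities for \<open>g\<close> on that block, then a word of \<open>f\<close>
  leaves at most \<open>Q ^ k\<close> possibilities for \<open>k\<close> consecutive blocks.\<close>

lemma entropy_fibre_bound: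
  assumes X: "shift_space X" and f: "local_code X rf f" and g: "local_code X rg g"
    and Zf: "shift_space (f ` X)" and Zg: "shift_space (g ` X)" and B: "B \<ge> 1"
    and Q: "\<And>x0. x0 \<in> X \<Longrightarrow>
      card {win (g x) 0 B |x. x \<in> X \<and> (\<forall>j. - int c \<le> j \<and> j < int (B + c) \<longrightarrow> f x j = f x0 j)} \<le> Q"
  shows "entropy (g ` X) \<le> entropy (f ` X) + ln (real Q) / real B"
proof (rule entropy_compare[OF Zg Zf B])
  fix k
  define fib where "fib k v = {win (g x) 0 (k * B) |x. x \<in> X \<and> win (f x) (- int c) (k * B + 2 * c) = v}" for k v
  define H where "H x0 = {win (g x) 0 B |x. x \<in> X \<and> (\<forall>j. - int c \<le> j \<and> j < int (B + c) \<longrightarrow> f x j = f x0 j)}" for x0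
  have fin: "finite (fib k v)" for k v
    by (rule finite_subset[OF _ finite_words[OF Zg, of "k * B"]]) (auto simp: fib_def words_eq)
  have finH: "finite (H x0)" for x0
    by (rule finite_subset[OF _ finite_words[OF Zg, of B]]) (auto simp: H_def words_eq)
  have fib: "card (fib k v) \<le> Q ^ k" for k v
  proof (induction k arbitrary: v)
    case 0
    have "fib 0 v \<subseteq> {[]}" by (auto simp: fib_def win_def)
    then show ?case using card_mono[of "{[]}" "fib 0 v"] by simp
  next
    case (Suc k)
    show ?case
    proof (cases "fib (Suc k) v = {}")
      case False
      then obtain x0 where x0: "x0 \<in> X" "win (f x0) (- int c) (Suc k * B + 2 * c) = v"
        by (auto simp: fib_def)
      let ?x0 = "translate (int (k * B)) x0"
      let ?v = "win (f x0) (- int c) (k * B + 2 * c)"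
      \<comment> \<open>Cut before the last block. Translated to the origin, that block is subject
        to the bound \<open>Q\<close>, because the known word of \<open>f\<close> reaches
        \<open>c\<close> positions beyond it on both sides.\<close>
      have "fib (Suc k) v \<subseteq> (\<lambda>(a, b). a @ b) ` (fib k ?v \<times> H ?x0)"
      proof
        fix u assume "u \<in> fib (Suc k) v"
        then obtain x where x: "x \<in> X" "win (f x) (- int c) (Suc k * B + 2 * c) = v"
          "u = win (g x) 0 (Suc k * B)" by (auto simp: fib_def)
        have eq: "f x j = f x0 j" if "- int c \<le> j" "j < int (Suc k * B) + int c" for j
          by (rule win_eqD[of "f x" "- int c" "Suc k * B + 2 * c" "f x0"]) (use that x(2) x0(2) in auto)
        have "win (f x) (- int c) (k * B + 2 * c) = ?v"
          by (rule win_eqI) (auto intro!: eq)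
        then have 1: "win (g x) 0 (k * B) \<in> fib k ?v" using x(1) by (auto simp: fib_def)
        have 2: "win (g (translate (int (k * B)) x)) 0 B \<in> H ?x0"
          unfolding H_def
        proof (intro CollectI exI[of _ "translate (int (k * B)) x"] conjI refl allI impI)
          show "translate (int (k * B)) x \<in> X" by (rule shift_spaceD(2)[OF X x(1)])
          fix j assume "- int c \<le> j \<and> j < int (B + c)"
          moreover have "int (Suc k * B) = int B + int (k * B)" "0 \<le> int (k * B)" by simp_all
          ultimately have "f x (j + int (k * B)) = f x0 (j + int (k * B))"
            by (intro eq) linarith+
          then show "f (translate (int (k * B)) x) j = f ?x0 j"
            unfolding local_code_translate[OF f x(1)] local_code_translate[OF f x0(1)] translate_apply .
        qed
        have "u = win (g x) 0 (k * B) @ win (g (translate (int (k * B)) x)) 0 B"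
          unfolding x(3) local_code_translate[OF g x(1)] win_translate
          using win_append[of "g x" 0 "k * B" B] by (simp only: mult_Suc add.commute[of B])
        then show "u \<in> (\<lambda>(a, b). a @ b) ` (fib k ?v \<times> H ?x0)" using 1 2 by auto
      qed
      then have "card (fib (Suc k) v) \<le> card (fib k ?v \<times> H ?x0)"
        by (meson card_image_le card_mono fin finH finite_SigmaI finite_imageI order_trans)
      also have "\<dots> = card (fib k ?v) * card (H ?x0)" by (rule card_cartesian_product)
      also have "\<dots> \<le> Q ^ k * Q"
        unfolding H_def by (intro mult_le_mono Suc Q shift_spaceD(2)[OF X] x0(1))
      finally show ?thesis by (simp add: mult.commute)
    qed simp
  qed
  have "words (k * B) (g ` X) \<subseteq> (\<Union>v\<in>words (k * B + 2 * c) (f ` X). fib k v)"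
    unfolding words_eq_0[OF Zg, of _ 0] by (auto simp: fib_def words_eq)
  then have "card (words (k * B) (g ` X)) \<le> card (\<Union>v\<in>words (k * B + 2 * c) (f ` X). fib k v)"
    using fin finite_words[OF Zf] by (intro card_mono) auto
  also have "\<dots> \<le> (\<Sum>v\<in>words (k * B + 2 * c) (f ` X). card (fib k v))"
    by (rule card_UN_le[OF finite_words[OF Zf]])
  also have "\<dots> \<le> card (words (k * B + 2 * c) (f ` X)) * Q ^ k"
    using sum_bounded_above[of "words (k * B + 2 * c) (f ` X)" "\<lambda>v. card (fib k v)" "Q ^ k"] fib by simp
  finally show "card (words (k * B) (g ` X)) \<le> card (words (k * B + 2 * c) (f ` X)) * Q ^ k" .
qed

text \<open>The fibre bound with the identity as known code, margin \<open>r\<close>, and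
  \<open>B = Q = 1\<close>: a window of radius \<open>r\<close> determines the image letter.\<close>

lemma entropy_image_le:
  assumes X: "shift_space X" and f: "local_code X r f" and Z: "shift_space (f ` X)"
  shows "entropy (f ` X) \<le> entropy X"
proof -
  have id: "local_code X 0 (\<lambda>x. x)" by (auto simp: local_code_def)
  have "entropy (f ` X) \<le> entropy ((\<lambda>x. x) ` X) + ln (real 1) / real 1"
  proof (rule entropy_fibre_bound[OF X id f _ Z, where c = r])
    fix x0 assume x0: "x0 \<in> X"
    have "{win (f x) 0 1 |x. x \<in> X \<and> (\<forall>j. - int r \<le> j \<and> j < int (1 + r) \<longrightarrow> x j = x0 j)} \<subseteq> {win (f x0) 0 1}"
    proof clarify
      fix x assume x: "x \<in> X" "\<forall>j. - int r \<le> j \<and> j < int (1 + r) \<longrightarrow> x j = x0 j"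
      have "x j = x0 j" if "\<bar>j - 0\<bar> \<le> int r" for j
        by (rule x(2)[rule_format]) (use that in auto)
      then have "f x 0 = f x0 0" by (rule local_codeD[OF f X x(1) x0])
      then show "win (f x) 0 1 = win (f x0) 0 1" by (simp add: win_eq_iff)
    qed
    from card_mono[OF _ this]
    show "card {win (f x) 0 1 |x. x \<in> X \<and> (\<forall>j. - int r \<le> j \<and> j < int (1 + r) \<longrightarrow> x j = x0 j)} \<le> 1"
      by simp
  qed (use X in auto)
  then show ?thesis by simp
qed

subsection \<open>Revealing words\<close>

lemma local_code_letterwise: "local_code Z 0 (\<lambda>z i. e (z i))"
  by (auto simp: local_code_def translate_def)

lemma local_code_letterwise_comp:
  assumes "local_code X r f"
  shows "local_code X r (\<lambda>x i. e (f x i))"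
proof -
  have "(\<lambda>i. e (f (translate k x) i)) = translate k (\<lambda>i. e (f x i))" if "x \<in> X" for k x
    unfolding local_code_translate[OF assms that] by (simp add: translate_def)
  moreover have "e (f x 0) = e (f x' 0)"
    if "x \<in> X" "x' \<in> X" "\<forall>j. \<bar>j\<bar> \<le> int r \<longrightarrow> x j = x' j" for x x'
    using assms that unfolding local_code_def by metis
  ultimately show ?thesis unfolding local_code_def by blast
qed

lemma entropy_letterwise_le:
  assumes Z: "shift_space Z"
  shows "entropy ((\<lambda>z i. e (z i)) ` Z) \<le> entropy Z"
proof -
  obtain D where D: "finite D" "\<And>z i. z \<in> Z \<Longrightarrow> z i \<in> D" using alphabet_obtain[OF Z] by blast
  have "shift_space ((\<lambda>z i. e (z i)) ` Z)"
    by (rule shift_space_image[OF local_code_letterwise Z, of "e ` D"]) (use D in auto)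
  then show ?thesis by (rule entropy_image_le[OF Z local_code_letterwise])
qed

lemma shift_space_letterwise:
  assumes Z: "shift_space Z"
  shows "shift_space ((\<lambda>z i. e (z i)) ` Z)"
proof -
  obtain D where D: "finite D" "\<And>z i. z \<in> Z \<Longrightarrow> z i \<in> D" using alphabet_obtain[OF Z] by blast
  show ?thesis
    by (rule shift_space_image[OF local_code_letterwise Z, of "e ` D"]) (use D in auto)
qed

lemma relabel_inverse:
  assumes e: "inj_on e D" and D: "\<And>z i. z \<in> Z \<Longrightarrow> z i \<in> D"
  shows "(\<lambda>z i. inv_into D e (z i)) ` (\<lambda>z i. e (z i)) ` Z = Z"
proof -
  have "(\<lambda>i. inv_into D e (e (z i))) = z" if "z \<in> Z" for z
    using D[OF that] by (simp add: inv_into_f_f[OF e])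
  then show ?thesis by (simp add: image_image)
qed

lemma entropy_relabel:
  assumes Z: "shift_space Z" and e: "inj_on e D" and D: "\<And>z i. z \<in> Z \<Longrightarrow> z i \<in> D"
  shows "entropy ((\<lambda>z i. e (z i)) ` Z) = entropy Z"
proof (rule antisym)
  show "entropy Z \<le> entropy ((\<lambda>z i. e (z i)) ` Z)"
    using entropy_letterwise_le[OF shift_space_letterwise[OF Z, of e], of "inv_into D e"]
    using relabel_inverse[of e D Z] e D by simp
qed (rule entropy_letterwise_le[OF Z])

lemma words_letterwise: "words n ((\<lambda>z i. e (z i)) ` Z) = map e ` words n Z"
proof -
  have "win (\<lambda>i. e (z i)) j n = map e (win z j n)" for z j
    by (simp add: win_def)
  then show ?thesis by (auto simp: words_eq)
qed

text \<open>Decoding letterwise turns admissible windows into admissible windows. Length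
  \<open>Suc M\<close> keeps the windows nonempty, so that each letter of \<open>z\<close> is seen
  to be a code letter.\<close>

lemma finite_type_relabel:
  assumes Z: "finite_type Z" and e: "inj_on e D" and D: "\<And>z i. z \<in> Z \<Longrightarrow> z i \<in> D"
  shows "finite_type ((\<lambda>z i. e (z i)) ` Z)"
proof -
  have Z': "shift_space Z" using Z by (simp add: finite_type_def)
  obtain M where M: "\<And>N x. M \<le> N \<Longrightarrow> (\<And>i. win x i N \<in> words N Z) \<Longrightarrow> x \<in> Z"
    using finite_typeE[OF Z] by blast
  show ?thesis
  proof (rule finite_typeI[OF shift_space_letterwise[OF Z', of e], of "Suc M"])
    fix z assume z: "\<And>i. win z i (Suc M) \<in> words (Suc M) ((\<lambda>z i. e (z i)) ` Z)"
    have ex: "\<exists>u\<in>words (Suc M) Z. win z i (Suc M) = map e u" for i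
      using z[of i] by (auto simp: words_letterwise)
    have uD: "set u \<subseteq> D" if "u \<in> words n Z" for u n
      using that D by (auto simp: words_eq win_def)
    define y where "y i = inv_into D e (z i)" for i
    have win_y: "win y i (Suc M) = u" if "win z i (Suc M) = map e u" "u \<in> words (Suc M) Z" for i u
    proof -
      have "win y i (Suc M) = map (inv_into D e) (win z i (Suc M))" by (simp add: win_def y_def)
      also have "\<dots> = map (\<lambda>a. inv_into D e (e a)) u" using that(1) by simp
      also have "\<dots> = u" using uD[OF that(2)] by (intro map_idI) (auto simp: inv_into_f_f[OF e])
      finally show ?thesis .
    qed
    have "y \<in> Z" by (rule M[of "Suc M"]) (use ex win_y in force)+
    moreover have "z i = e (y i)" for i
    proof -
      obtain u where u: "u \<in> words (Suc M) Z" "win z i (Suc M) = map e u" using ex by blast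
      have "z i = e (u ! 0)" "u ! 0 = y i"
        using arg_cong[OF u(2), of "\<lambda>l. l ! 0"] arg_cong[OF win_y[OF u(2,1)], of "\<lambda>l. l ! 0"]
          arg_cong[OF u(2), of length] by (auto simp del: upt_Suc simp flip: length_greater_0_conv)
      then show ?thesis by simp
    qed
    ultimately show "z \<in> (\<lambda>z i. e (z i)) ` Z" by auto
  qed
qed

lemma entropy_factor_le:
  assumes "factor_code X Y f"
  shows "entropy Y \<le> entropy X"
proof -
  have X: "shift_space X" and Y: "shift_space Y" and im: "f ` X = Y"
    using assms by (auto simp: factor_code_def code_def)
  obtain r where "local_code X r f" using factor_code_imp_local[OF assms] by blast
  then show ?thesis using entropy_image_le[OF X] Y im by blast
qed

text \<open>The interface to the sets of intermediate entropies. Codes are built below over whatever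
  alphabet is convenient; an injection of the finitely many letters into the natural numbers makes
  them intermediate factors and changes neither entropy nor finite type.\<close>

lemma decomposes_letterwise:
  fixes \<phi> :: "(int \<Rightarrow> 'a) \<Rightarrow> (int \<Rightarrow> 'b)" and \<psi> :: "(int \<Rightarrow> 'a) \<Rightarrow> (int \<Rightarrow> 'c)"
  assumes \<phi>: "factor_code X Y \<phi>" and \<psi>: "local_code X r \<psi>" and D: "finite D" "\<And>x. x \<in> X \<Longrightarrow> \<psi> x 0 \<in> D"
    and \<pi>: "\<And>x. x \<in> X \<Longrightarrow> \<phi> x 0 = \<pi> (\<psi> x 0)"
  shows "entropy (\<psi> ` X) \<in> intermediate_entropies X Y \<phi>"
    and "finite_type (\<psi> ` X) \<Longrightarrow> entropy (\<psi> ` X) \<in> intermediate_entropies_ft X Y \<phi>"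
proof -
  have X: "shift_space X" and Y: "shift_space Y" and im: "\<phi> ` X = Y"
    using \<phi> by (auto simp: factor_code_def code_def)
  obtain r' where \<phi>': "local_code X r' \<phi>" using factor_code_imp_local[OF \<phi>] by blast
  have all_D: "\<psi> x i \<in> D" and all_pi: "\<phi> x i = \<pi> (\<psi> x i)" if "x \<in> X" for x i
    using D(2)[OF shift_spaceD(2)[OF X that, of i]] \<pi>[OF shift_spaceD(2)[OF X that, of i]]
    unfolding local_code_translate[OF \<psi> that] local_code_translate[OF \<phi>' that] translate_apply
    by simp_all
  have Z: "shift_space (\<psi> ` X)" by (rule shift_space_image[OF \<psi> X D])
  obtain e :: "'c \<Rightarrow> nat" where e: "inj_on e D"
    using finite_imp_inj_to_nat_seg[OF D(1)] by blast
  define \<phi>1 where "\<phi>1 x = (\<lambda>i. e (\<psi> x i))" for x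
  define \<phi>2 where "\<phi>2 z = (\<lambda>i. \<pi> (inv_into D e (z i)))" for z :: "int \<Rightarrow> nat"
  have im1: "\<phi>1 ` X = (\<lambda>z i. e (z i)) ` \<psi> ` X" by (auto simp: \<phi>1_def)
  have loc1: "local_code X r \<phi>1"
    unfolding \<phi>1_def by (rule local_code_letterwise_comp[OF \<psi>])
  have Z1: "shift_space (\<phi>1 ` X)" unfolding im1 by (rule shift_space_letterwise[OF Z])
  have comp: "\<phi> x = \<phi>2 (\<phi>1 x)" if "x \<in> X" for x
    using all_D[OF that] all_pi[OF that] by (auto simp: \<phi>1_def \<phi>2_def inv_into_f_f[OF e])
  have im2: "\<phi>2 ` \<phi>1 ` X = Y" using comp im by (auto simp: image_image)
  have loc2: "local_code (\<phi>1 ` X) 0 \<phi>2" unfolding \<phi>2_def by (rule local_code_letterwise)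
  have "factor_code (\<phi>1 ` X) (\<phi>2 ` \<phi>1 ` X) \<phi>2"
    by (rule factor_code_local[OF loc2 Z1]) (simp add: im2 Y)
  then have dec: "decomposes X Y \<phi> \<phi>1 \<phi>2"
    unfolding decomposes_def using factor_code_local[OF loc1 X Z1] comp im2 by auto
  have ent: "entropy (\<psi> ` X) = entropy (\<phi>1 ` X)"
    unfolding im1 by (rule entropy_relabel[OF Z e, symmetric]) (use all_D in auto)
  show "entropy (\<psi> ` X) \<in> intermediate_entropies X Y \<phi>"
    unfolding ent intermediate_entropies_def using dec by blast
  assume "finite_type (\<psi> ` X)"
  then have "finite_type (\<phi>1 ` X)"
    unfolding im1 by (rule finite_type_relabel[OF _ e]) (use all_D in auto)
  then show "entropy (\<psi> ` X) \<in> intermediate_entropies_ft X Y \<phi>"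
    unfolding ent intermediate_entropies_ft_def using dec by blast
qed

section \<open>Occurrences of one word in a short block\<close>

definition periodic_on :: "(int \<Rightarrow> 'b) \<Rightarrow> int \<Rightarrow> int \<Rightarrow> int \<Rightarrow> bool" where
  "periodic_on y a b p \<longleftrightarrow> (\<forall>t. a \<le> t \<and> t + p < b \<longrightarrow> y (t + p) = y t)"

lemma periodic_onD: "periodic_on y a b p \<Longrightarrow> a \<le> t \<Longrightarrow> t + p < b \<Longrightarrow> y (t + p) = y t"
  by (simp add: periodic_on_def)

lemma periodic_on_subset: "periodic_on y a b p \<Longrightarrow> a \<le> a' \<Longrightarrow> b' \<le> b \<Longrightarrow> periodic_on y a' b' p"
  by (auto simp: periodic_on_def)

lemma periodic_on_iterate:
  assumes "periodic_on y a b p" "0 \<le> p" "a \<le> t" "t + int k * p < b"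
  shows "y (t + int k * p) = y t"
  using assms(4)
proof (induction k)
  case (Suc k)
  have kp: "0 \<le> int k * p" "int (Suc k) * p = int k * p + p" using assms(2) by (auto simp: algebra_simps)
  have "y (t + int k * p + p) = y (t + int k * p)"
    by (rule periodic_onD[OF assms(1)]) (use Suc.prems kp assms(3) in linarith)+
  moreover have "y (t + int k * p) = y t"
    by (rule Suc.IH) (use Suc.prems kp assms(2) in linarith)
  ultimately show ?case unfolding kp by (simp only: add.assoc)
qed simp

text \<open>Three parameters below \<open>B\<close> describe the set, whence the count
  \<open>B ^ 3\<close>. Step 0 covers the case of a single occurrence.\<close>

definition progression :: "int \<times> int \<times> int \<Rightarrow> int set" where
  "progression = (\<lambda>(a, b, p). {j. \<exists>k. j = a + int k * p \<and> j \<le> b})"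

text \<open>Windows of length \<open>2 * B\<close> starting in a block of length \<open>B\<close>
  overlap in more than \<open>B\<close> letters, so the distance \<open>p\<close> between the first
  two occurrences is a period of \<open>x\<close> on everything the occurrences cover. Moving an
  occurrence by multiples of \<open>p\<close> between the first and the last one then gives
  occurrences again.\<close>

lemma occurrences_progression:
  fixes x :: "int \<Rightarrow> 'a" and w :: "'a list" and B :: nat
  defines "Occ \<equiv> {j \<in> {0..<int B}. win x j (2 * B) = w}"
  shows "Occ \<in> insert {} (progression ` ({0..<int B} \<times> {0..<int B} \<times> {0..<int B}))"
proof (cases "Occ = {}")
  case False
  have fin: "finite Occ" unfolding Occ_def by (rule finite_subset[of _ "{0..<int B}"]) auto
  define a b where "a = Min Occ" and "b = Max Occ"
  have a: "a \<in> Occ" and b: "b \<in> Occ" using fin False by (auto simp: a_def b_def)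
  have ab: "a \<le> j" "j \<le> b" if "j \<in> Occ" for j using that fin by (auto simp: a_def b_def)
  have range: "0 \<le> a" "a < int B" "0 \<le> b" "b < int B" using a b by (auto simp: Occ_def)
  have Occ: "win x j (2 * B) = w" if "j \<in> Occ" for j using that by (simp add: Occ_def)
  show ?thesis
  proof (cases "Occ - {a} = {}")
    case True
    then have "Occ = {a}" using a by blast
    also have "\<dots> = progression (a, a, 0)" by (auto simp: progression_def)
    finally show ?thesis using range by (auto intro!: rev_image_eqI)
  next
    case False
    define c where "c = Min (Occ - {a})"
    define p where "p = c - a"
    have c: "c \<in> Occ" "c \<noteq> a" using Min_in[of "Occ - {a}"] fin False by (auto simp: c_def)
    have cmin: "c \<le> j" if "j \<in> Occ" "j \<noteq> a" for j using that fin by (auto simp: c_def)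
    have p: "0 < p" "p < int B" using c ab(1)[of c] range by (auto simp: p_def Occ_def)
    have near: "x (t + p) = x t" if t: "a \<le> t" "t < a + 2 * int B" for t
    proof -
      have "win x c (2 * B) = win x a (2 * B)" using Occ a c by simp
      moreover have "nat (t - a) < 2 * B" using t by auto
      ultimately have "x (c + int (nat (t - a))) = x (a + int (nat (t - a)))"
        unfolding win_eq_iff by blast
      then show ?thesis using t by (simp add: p_def algebra_simps)
    qed
    \<comment> \<open>Beyond the first window the letters lie in the window at the last occurrence
      \<open>b\<close>, which copies the window at \<open>a\<close>.\<close>
    have per: "x (t + p) = x t" if t: "a \<le> t" "t + p < b + 2 * int B" for t
    proof (cases "t < a + 2 * int B")
      case False
      then have tb: "b \<le> t" using range by simp
      have "win x b (2 * B) = win x a (2 * B)" using Occ a b by simp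
      then have eq: "x (b + int k) = x (a + int k)" if "k < 2 * B" for k
        unfolding win_eq_iff using that by blast
      have "x (t + p) = x (a + (t + p - b))" using eq[of "nat (t + p - b)"] t tb p by simp
      also have "\<dots> = x (a + (t - b))" using near[of "a + (t - b)"] t tb p by (simp add: algebra_simps)
      also have "\<dots> = x t" using eq[of "nat (t - b)"] t tb p by simp
      finally show ?thesis .
    qed (use near t in blast)
    have periter: "x (t + int k * p) = x t" if "a \<le> t" "t + int k * p < b + 2 * int B" for t k
      by (rule periodic_on_iterate[of x a "b + 2 * int B" p])
        (use per p that in \<open>auto simp: periodic_on_def\<close>)
    have shift_eq: "win x (t + int k * p) (2 * B) = win x t (2 * B)"
      if "a \<le> t" "t + int k * p \<le> b" for t k
      unfolding win_eq_iff
    proof (intro allI impI)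
      fix i assume "i < 2 * B"
      then have "x (t + int i + int k * p) = x (t + int i)"
        using that by (intro periter) auto
      moreover have "t + int k * p + int i = t + int i + int k * p" by simp
      ultimately show "x (t + int k * p + int i) = x (t + int i)" by (simp only:)
    qed
    have "Occ = progression (a, b, p)"
    proof (intro equalityI subsetI)
      fix j assume j: "j \<in> Occ"
      define k where "k = nat ((j - a) div p)"
      \<comment> \<open>The representative of \<open>j\<close> modulo \<open>p\<close> in
        \<open>{a..<a + p}\<close>. It is an occurrence, so minimality of the second occurrence
        \<open>c = a + p\<close> forces it to be \<open>a\<close>.\<close>
      define j' where "j' = a + (j - a) mod p"
      have k: "int k = (j - a) div p" using ab(1)[OF j] p by (simp add: k_def pos_imp_zdiv_nonneg_iff)
      have jj: "j = j' + int k * p" unfolding j'_def k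
        by (metis add.assoc add.commute diff_add_cancel mod_mult_div_eq mult.commute)
      have j'a: "a \<le> j'" "j' < a + p" using p by (auto simp: j'_def)
      have "0 \<le> int k * p" using p by simp
      then have "j' \<le> j" using jj by simp
      moreover have "win x j' (2 * B) = w"
        using shift_eq[of j' k] Occ[OF j] jj ab[OF j] j'a by simp
      ultimately have "j' \<in> Occ" using j'a range j by (auto simp: Occ_def)
      then have "j' = a" using cmin[of j'] j'a by (force simp: p_def)
      then show "j \<in> progression (a, b, p)" using jj ab[OF j] by (auto simp: progression_def)
    next
      fix j assume "j \<in> progression (a, b, p)"
      then obtain k where k: "j = a + int k * p" "j \<le> b" by (auto simp: progression_def)
      have "0 \<le> int k * p" using p by simp
      then have "j \<in> {0..<int B}" using k range by auto
      moreover have "win x j (2 * B) = w" using shift_eq[of a k] k Occ[OF a] by simp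
      ultimately show "j \<in> Occ" by (simp add: Occ_def)
    qed
    then show ?thesis using range p by (auto intro!: rev_image_eqI)
  qed
qed simp

section \<open>Interpolation by revealed words\<close>

definition reveal :: "nat \<Rightarrow> 'a list set \<Rightarrow> ((int \<Rightarrow> 'a) \<Rightarrow> int \<Rightarrow> 'b) \<Rightarrow> (int \<Rightarrow> 'a) \<Rightarrow> int \<Rightarrow> 'b \<times> 'a list option" where
  "reveal n C \<phi> x = (\<lambda>i. (\<phi> x i, if win x i n \<in> C then Some (win x i n) else None))"

lemma local_code_reveal:
  assumes "local_code X r \<phi>"
  shows "local_code X (r + n) (reveal n C \<phi>)"
proof -
  have "reveal n C \<phi> x 0 = reveal n C \<phi> x' 0"
    if "x \<in> X" "x' \<in> X" and eq: "\<forall>j. \<bar>j\<bar> \<le> int (r + n) \<longrightarrow> x j = x' j" for x x'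
  proof -
    have "\<forall>j. \<bar>j\<bar> \<le> int r \<longrightarrow> x j = x' j" using eq by simp
    then have "\<phi> x 0 = \<phi> x' 0" using assms that(1,2) unfolding local_code_def by blast
    moreover have "win x 0 n = win x' 0 n" by (rule win_eqI) (use eq in auto)
    ultimately show ?thesis by (simp add: reveal_def)
  qed
  moreover have "reveal n C \<phi> (translate k x) = translate k (reveal n C \<phi> x)" if "x \<in> X" for x k
    using local_code_translate[OF assms that] unfolding reveal_def win_translate
    by (auto simp: translate_def)
  ultimately show ?thesis unfolding local_code_def by blast
qed

lemma reveal_alphabet:
  assumes "x \<in> X" "\<phi> x 0 \<in> D"
  shows "reveal n C \<phi> x 0 \<in> D \<times> insert None (Some ` words n X)"
  using assms win_in_words[of x X 0 n] by (auto simp: reveal_def)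

lemma shift_space_reveal:
  assumes X: "shift_space X" and \<phi>: "local_code X r \<phi>" and D: "finite D" "\<And>x. x \<in> X \<Longrightarrow> \<phi> x 0 \<in> D"
  shows "shift_space (reveal n C \<phi> ` X)"
  by (rule shift_space_image[OF local_code_reveal[OF \<phi>] X _ reveal_alphabet[where D = D and X = X]])
    (use D finite_words[OF X] in auto)

text \<open>The block before revealing \<open>w\<close> and the set of occurrences of
  \<open>w\<close> determine the block afterwards. That set is empty or one of at most
  \<open>B ^ 3\<close> progressions.\<close>

lemma entropy_reveal_insert:
  assumes X: "shift_space X" and \<phi>: "local_code X r \<phi>" and D: "finite D" "\<And>x. x \<in> X \<Longrightarrow> \<phi> x 0 \<in> D"
    and B: "B \<ge> 1"
  shows "entropy (reveal (2 * B) (insert w C) \<phi> ` X) \<le>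
    entropy (reveal (2 * B) C \<phi> ` X) + ln (real (B ^ 3 + 1)) / real B"
proof (rule entropy_fibre_bound[OF X local_code_reveal[OF \<phi>] local_code_reveal[OF \<phi>]
      shift_space_reveal[OF X \<phi> D] shift_space_reveal[OF X \<phi> D] B, where c = 0])
  fix x0
  let ?f = "reveal (2 * B) C \<phi>" and ?g = "reveal (2 * B) (insert w C) \<phi>"
  let ?I = "{0..<int B}"
  let ?S = "insert {} (progression ` (?I \<times> ?I \<times> ?I))"
  let ?h = "\<lambda>Occ. map (\<lambda>k. (fst (?f x0 (int k)), if int k \<in> Occ then Some w else snd (?f x0 (int k)))) [0..<B]"
  have "{win (?g x) 0 B |x. x \<in> X \<and> (\<forall>j. - int 0 \<le> j \<and> j < int (B + 0) \<longrightarrow> ?f x j = ?f x0 j)} \<subseteq> ?h ` ?S"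
  proof clarify
    fix x assume eq: "\<forall>j. - int 0 \<le> j \<and> j < int (B + 0) \<longrightarrow> ?f x j = ?f x0 j"
    let ?O = "{j \<in> ?I. win x j (2 * B) = w}"
    have "?g x (int k) = (fst (?f x0 (int k)), if int k \<in> ?O then Some w else snd (?f x0 (int k)))" if "k < B" for k
    proof -
      have "?f x0 (int k) = ?f x (int k)" using eq that by simp
      then show ?thesis using that by (auto simp: reveal_def)
    qed
    then have "win (?g x) 0 B = ?h ?O" by (simp add: win_def)
    then show "win (?g x) 0 B \<in> ?h ` ?S" using occurrences_progression[of B x w] by blast
  qed
  moreover have "finite ?S" by simp
  ultimately have "card {win (?g x) 0 B |x. x \<in> X \<and> (\<forall>j. - int 0 \<le> j \<and> j < int (B + 0) \<longrightarrow> ?f x j = ?f x0 j)} \<le> card ?S"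
    by (meson card_image_le card_mono finite_imageI order_trans)
  also have "\<dots> \<le> Suc (card (progression ` (?I \<times> ?I \<times> ?I)))" by (simp add: card_insert_if)
  also have "\<dots> \<le> Suc (card (?I \<times> ?I \<times> ?I))" using card_image_le[of "?I \<times> ?I \<times> ?I" progression] by simp
  also have "\<dots> = B ^ 3 + 1" by (simp add: card_cartesian_product power3_eq_cube)
  finally show "card {win (?g x) 0 B |x. x \<in> X \<and> (\<forall>j. - int 0 \<le> j \<and> j < int (B + 0) \<longrightarrow> ?f x j = ?f x0 j)} \<le> B ^ 3 + 1" .
qed

text \<open>A discrete intermediate value argument with a bound on upward steps only: the least
  \<open>k\<close> with \<open>t \<le> a k\<close> works, since its predecessor is still below
  \<open>t\<close>.\<close>

lemma small_steps_approximate: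
  fixes a :: "nat \<Rightarrow> real"
  assumes "a 0 \<le> t" "t \<le> a K" and step: "\<And>k. k < K \<Longrightarrow> a (Suc k) \<le> a k + e" and "e > 0"
  obtains k where "\<bar>a k - t\<bar> \<le> e"
proof -
  define k where "k = (LEAST k. t \<le> a k)"
  have k: "t \<le> a k" "k \<le> K" unfolding k_def by (rule LeastI[of _ K], fact, rule Least_le, fact)
  show ?thesis
  proof (cases k)
    case 0
    then show ?thesis using k assms that[of 0] by auto
  next
    case (Suc l)
    then have "a l < t" using not_less_Least[of l "\<lambda>k. t \<le> a k"] by (auto simp: k_def)
    then show ?thesis using step[of l] k Suc that[of k] by auto
  qed
qed

lemma entropy_reveal_dense:
  assumes X: "shift_space X" and \<phi>: "local_code X r \<phi>" and D: "finite D" "\<And>x. x \<in> X \<Longrightarrow> \<phi> x 0 \<in> D"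
    and t: "entropy (\<phi> ` X) \<le> t" "t \<le> entropy X" and e: "e > 0"
  obtains n C where "\<bar>entropy (reveal n C \<phi> ` X) - t\<bar> \<le> e"
proof -
  have "(\<lambda>B::nat. ln (real (B ^ 3 + 1)) / real B) \<longlonglongrightarrow> 0" by real_asymp
  then have "\<forall>\<^sub>F B::nat in sequentially. ln (real (B ^ 3 + 1)) / real B < e"
    using e by (rule order_tendstoD(2))
  then obtain B :: nat where B: "B \<ge> 1" "ln (real (B ^ 3 + 1)) / real B < e"
    using eventually_conj[OF _ eventually_ge_at_top[of "1::nat"]] eventually_happens'[OF sequentially_bot]
    by (metis (mono_tags, lifting))
  obtain ws where ws: "set ws = words (2 * B) X" using finite_list[OF finite_words[OF X]] by blast
  define a where "a k = entropy (reveal (2 * B) (set (take k ws)) \<phi> ` X)" for k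
  have "a 0 \<le> entropy (\<phi> ` X)"
  proof -
    have "reveal (2 * B) {} \<phi> ` X = (\<lambda>z i. (z i, None)) ` \<phi> ` X" by (auto simp: reveal_def)
    then show ?thesis unfolding a_def
      using entropy_letterwise_le[OF shift_space_image[OF \<phi> X D]] by simp
  qed
  \<comment> \<open>With all words revealed, the head of the word revealed at a position is the
    letter of \<open>x\<close> there, so \<open>X\<close> is a letterwise image.\<close>
  moreover have "entropy X \<le> a (length ws)"
  proof -
    let ?r = "reveal (2 * B) (words (2 * B) X) \<phi>"
    have "(\<lambda>i. hd (the (snd (?r x i)))) = x" if "x \<in> X" for x
      using win_in_words[OF that, of _ "2 * B"] B(1) by (auto simp: reveal_def win_def hd_map)
    then have "(\<lambda>z i. hd (the (snd (z i)))) ` ?r ` X = X" by (simp add: image_image)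
    then show ?thesis unfolding a_def
      using entropy_letterwise_le[OF shift_space_reveal[OF X \<phi> D], of "\<lambda>v. hd (the (snd v))" "2 * B" "words (2 * B) X"] ws
      by simp
  qed
  moreover have "a (Suc k) \<le> a k + e" if k: "k < length ws" for k
  proof -
    have "set (take (Suc k) ws) = insert (ws ! k) (set (take k ws))"
      using k by (simp add: take_Suc_conv_app_nth)
    then have "a (Suc k) \<le> a k + ln (real (B ^ 3 + 1)) / real B"
      unfolding a_def using entropy_reveal_insert[OF X \<phi> D B(1)] by simp
    then show ?thesis using B(2) by simp
  qed
  ultimately obtain k where "\<bar>a k - t\<bar> \<le> e"
    using small_steps_approximate[of a t "length ws" e] t e by (metis order_trans)
  then show ?thesis using that by (auto simp: a_def)
qed

subsection \<open>Periodic stretches and markers\<close>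

text \<open>A Fine-Wilf argument: on the overlap, \<open>y (t + p)\<close> and \<open>y t\<close>
  can be pulled back by \<open>q\<close> without change, which brings the equation closer to the
  region where it is known.\<close>

lemma periodic_on_extend_right:
  assumes p: "periodic_on y a b p" and q: "periodic_on y c d q"
    and "0 < p" "0 < q" "a \<le> c" "c + p + q \<le> b"
  shows "periodic_on y a d p"
proof -
  have "y (t + p) = y t" if "a \<le> t" "t + p < d" for t
    using that
  proof (induction "nat (t - a)" arbitrary: t rule: less_induct)
    case less
    show ?case
    proof (cases "t + p < b")
      case True
      then show ?thesis using periodic_onD[OF p] less.prems by blast
    next
      case False
      have "y (t - q + p + q) = y (t - q + p)" "y (t - q + q) = y (t - q)"
        using False less.prems assms(3-6) by (intro periodic_onD[OF q]; linarith)+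
      moreover have "y (t - q + p) = y (t - q)"
        using False less.prems assms(3-6) by (intro less.hyps) linarith+
      ultimately show ?thesis by simp
    qed
  qed
  then show ?thesis by (simp add: periodic_on_def)
qed

lemma periodic_on_extend_left:
  assumes p: "periodic_on y a d p" and q: "periodic_on y c d q"
    and "0 < p" "0 < q" "c + p + q \<le> d"
  shows "periodic_on y a d q"
  unfolding periodic_on_def
proof (intro allI impI, elim conjE)
  fix t assume t: "a \<le> t" "t + q < d"
  show "y (t + q) = y t"
  proof (cases "c \<le> t")
    case True
    then show ?thesis using periodic_onD[OF q] t by blast
  next
    case False
    \<comment> \<open>The number of periods \<open>p\<close>, rounded up, that carries
      \<open>t\<close> into \<open>{c..<c + p}\<close>, where the period \<open>q\<close> is
      available.\<close>
    define k where "k = nat ((c - t + p - 1) div p)"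
    have "int k = (c - t + p - 1) div p"
      using False assms(3) by (simp add: k_def pos_imp_zdiv_nonneg_iff)
    then have "int k * p = c - t + p - 1 - (c - t + p - 1) mod p"
      by (simp add: minus_mod_eq_div_mult)
    moreover have "0 \<le> (c - t + p - 1) mod p" "(c - t + p - 1) mod p < p" using assms(3) by simp_all
    ultimately have k: "c \<le> t + int k * p" "t + int k * p < c + p" by linarith+
    have "y (t + q + int k * p) = y (t + q)" "y (t + int k * p) = y t"
      using k t assms(3-5) by (intro periodic_on_iterate[OF p]; linarith)+
    moreover have "y (t + int k * p + q) = y (t + int k * p)"
      using k assms(5) by (intro periodic_onD[OF q]) linarith+
    moreover have "t + q + int k * p = t + int k * p + q" by simp
    ultimately show ?thesis by (simp only:)
  qed
qed

definition is_per :: "nat \<Rightarrow> nat \<Rightarrow> (int \<Rightarrow> 'b) \<Rightarrow> int \<Rightarrow> bool" where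
  "is_per n N y i \<longleftrightarrow> (\<exists>p. 0 < p \<and> p < n \<and> periodic_on y i (i + int N) (int p))"

definition min_per :: "nat \<Rightarrow> (int \<Rightarrow> 'b) \<Rightarrow> int \<Rightarrow> nat" where
  "min_per N y i = (LEAST p. 0 < p \<and> periodic_on y i (i + int N) (int p))"

lemma min_per:
  assumes "is_per n N y i"
  shows "0 < min_per N y i" "min_per N y i < n" "periodic_on y i (i + int N) (int (min_per N y i))"
proof -
  obtain p where p: "0 < p \<and> periodic_on y i (i + int N) (int p)" "p < n"
    using assms by (auto simp: is_per_def)
  show "0 < min_per N y i" "periodic_on y i (i + int N) (int (min_per N y i))"
    using LeastI[of "\<lambda>p. 0 < p \<and> periodic_on y i (i + int N) (int p)", OF p(1)]
    unfolding min_per_def by blast+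
  show "min_per N y i < n"
    using Least_le[of "\<lambda>p. 0 < p \<and> periodic_on y i (i + int N) (int p)", OF p(1)] p(2)
    unfolding min_per_def by linarith
qed

lemma min_per_le: "0 < p \<Longrightarrow> periodic_on y i (i + int N) (int p) \<Longrightarrow> min_per N y i \<le> p"
  unfolding min_per_def by (rule Least_le) simp

text \<open>The windows at \<open>i\<close> and \<open>j\<close> share at least \<open>2 * n\<close>
  letters, more than the sum of their least periods, so each period extends over the other
  window.\<close>

lemma per_run:
  assumes i: "is_per n N y i" and j: "is_per n N y j" and ij: "i \<le> j" "j - i + 2 * int n \<le> int N"
  shows "periodic_on y i (j + int N) (int (min_per N y i))" "min_per N y j = min_per N y i"
    and "i \<le> k \<Longrightarrow> k \<le> j \<Longrightarrow> is_per n N y k"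
proof -
  let ?p = "min_per N y i" and ?q = "min_per N y j"
  note p = min_per[OF i] and q = min_per[OF j]
  show run: "periodic_on y i (j + int N) (int ?p)"
    by (rule periodic_on_extend_right[OF p(3) q(3)]) (use p q ij in auto)
  have "?q \<le> ?p"
    by (rule min_per_le[OF p(1)]) (rule periodic_on_subset[OF run], use ij in auto)
  moreover have "periodic_on y i (j + int N) (int ?q)"
    by (rule periodic_on_extend_left[OF run q(3)]) (use p q ij in auto)
  then have "?p \<le> ?q"
    by (intro min_per_le[OF q(1)]) (rule periodic_on_subset, use ij in auto)
  ultimately show "?q = ?p" by simp
  show "is_per n N y k" if "i \<le> k" "k \<le> j"
    unfolding is_per_def using p(1,2) periodic_on_subset[OF run, of k "k + int N"] that by auto
qed

text \<open>For runs too long for their end windows to overlap: the period is handed from each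
  position to the next, and windows at consecutive positions always overlap enough.\<close>

lemma per_interval:
  assumes per: "\<And>k. i \<le> k \<Longrightarrow> k \<le> i + int l \<Longrightarrow> is_per n N y k" and N: "2 * n + 1 \<le> N"
  shows "min_per N y (i + int l) = min_per N y i \<and>
    periodic_on y i (i + int l + int N) (int (min_per N y i))"
  using per
proof (induction l)
  case 0
  then show ?case using min_per(3)[of n N y i] by simp
next
  case (Suc l)
  have IH: "min_per N y (i + int l) = min_per N y i"
    "periodic_on y i (i + int l + int N) (int (min_per N y i))"
    using Suc by auto
  have 1: "is_per n N y (i + int l)" "is_per n N y (i + int (Suc l))" using Suc.prems by auto
  have run: "periodic_on y (i + int l) (i + int (Suc l) + int N) (int (min_per N y i))"
    "min_per N y (i + int (Suc l)) = min_per N y i"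
    using per_run(1,2)[OF 1] N IH(1) by auto
  have p: "0 < min_per N y i" "min_per N y i < n" using min_per[of n N y i] Suc.prems[of i] by auto
  have "periodic_on y i (i + int (Suc l) + int N) (int (min_per N y i))"
    by (rule periodic_on_extend_right[OF IH(2) run(1)]) (use p N in auto)
  then show ?case using run(2) by simp
qed

lemma is_per_cong:
  assumes "win y i N = win y' i' N"
  shows "is_per n N y i = is_per n N y' i'" "min_per N y i = min_per N y' i'"
proof -
  have eq: "y (i + int k) = y' (i' + int k)" if "k < N" for k
    using assms that by (auto simp: win_eq_iff)
  have "periodic_on y i (i + int N) (int p) = periodic_on y' i' (i' + int N) (int p)" for p
  proof -
    have "periodic_on y i (i + int N) (int p) \<longleftrightarrow> (\<forall>k. k + p < N \<longrightarrow> y (i + int (k + p)) = y (i + int k))"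
      for y :: "int \<Rightarrow> 'a" and i
    proof
      assume "periodic_on y i (i + int N) (int p)"
      then show "\<forall>k. k + p < N \<longrightarrow> y (i + int (k + p)) = y (i + int k)"
        using periodic_onD[of y i "i + int N" "int p" "i + int k" for k] by (auto simp: add.assoc)
    next
      assume H: "\<forall>k. k + p < N \<longrightarrow> y (i + int (k + p)) = y (i + int k)"
      show "periodic_on y i (i + int N) (int p)"
        unfolding periodic_on_def
      proof (intro allI impI, elim conjE)
        fix t assume "i \<le> t" "t + int p < i + int N"
        then show "y (t + int p) = y t" using H[rule_format, of "nat (t - i)"] by (simp add: algebra_simps)
      qed
    qed
    moreover have "(k + p < N \<longrightarrow> y (i + int (k + p)) = y (i + int k)) \<longleftrightarrow>
        (k + p < N \<longrightarrow> y' (i' + int (k + p)) = y' (i' + int k))" for k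
      using eq[of "k + p"] eq[of k] by force
    ultimately show ?thesis by presburger
  qed
  then show "is_per n N y i = is_per n N y' i'" "min_per N y i = min_per N y' i'"
    by (auto simp: is_per_def min_per_def)
qed

text \<open>Krieger markers by a greedy choice along a ranking of the windows. Equal windows at distance
  below \<open>n\<close> would make the position periodic, which is why markers are separated.\<close>

function marked :: "nat \<Rightarrow> nat \<Rightarrow> ('b list \<Rightarrow> nat) \<Rightarrow> (int \<Rightarrow> 'b) \<Rightarrow> int \<Rightarrow> bool" where
  "marked n N rk y i = (\<not> is_per n N y i \<and>
     (\<forall>j\<in>{j. \<bar>j - i\<bar> < int n \<and> rk (win y j N) < rk (win y i N)}. \<not> marked n N rk y j))"
  by pat_completeness auto
termination by (relation "Wellfounded.measure (\<lambda>(n, N, rk, y, i). rk (win y i N))") auto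

declare marked.simps [simp del]

lemma marked_not_per: "marked n N rk y i \<Longrightarrow> \<not> is_per n N y i"
  by (subst (asm) marked.simps) simp

lemma marked_separated:
  assumes "marked n N rk y i" "marked n N rk y j" "i < j"
    and inj: "\<And>i j. rk (win y i N) = rk (win y j N) \<Longrightarrow> win y i N = win y j N"
  shows "int n \<le> j - i"
proof (rule ccontr)
  assume "\<not> int n \<le> j - i"
  then have near: "\<bar>j - i\<bar> < int n" "\<bar>i - j\<bar> < int n" using assms(3) by auto
  have "\<not> rk (win y j N) < rk (win y i N)"
    using assms(1,2) near(1) by (subst (asm) (1) marked.simps) auto
  moreover have "\<not> rk (win y i N) < rk (win y j N)"
    using assms(1,2) near(2) by (subst (asm) (2) marked.simps) auto
  ultimately have eq: "win y i N = win y j N" using inj by simp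
  have "periodic_on y i (i + int N) (int (nat (j - i)))"
    unfolding periodic_on_def
  proof (intro allI impI, elim conjE)
    fix t assume t: "i \<le> t" "t + int (nat (j - i)) < i + int N"
    have "y (i + int (nat (t - i))) = y (j + int (nat (t - i)))"
      by (rule eq[unfolded win_eq_iff, rule_format]) (use t assms(3) in linarith)
    then show "y (t + int (nat (j - i))) = y t" using t assms(3) by (simp add: algebra_simps)
  qed
  then have "is_per n N y i" unfolding is_per_def using near assms(3) by (intro exI[of _ "nat (j - i)"]) auto
  then show False using marked_not_per assms(1) by blast
qed

text \<open>The greedy choice rejects a nonperiodic position only because of a marker
  nearby.\<close>

lemma marked_dense:
  assumes "\<not> is_per n N y i" "n \<ge> 1"
  obtains j where "\<bar>j - i\<bar> < int n" "marked n N rk y j"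
proof (cases "marked n N rk y i")
  case True
  then show ?thesis using that[of i] assms by simp
next
  case False
  then show ?thesis using assms that by (subst (asm) marked.simps) auto
qed

text \<open>Each level of the recursion lowers the rank and moves by less than \<open>n\<close>.
  Starting from rank at most \<open>k\<close>, it therefore reads only \<open>n * k\<close>
  positions to either side, plus a window.\<close>

lemma marked_local:
  assumes "rk (win y i N) \<le> k"
    and "\<And>j. i - int (n * k) \<le> j \<Longrightarrow> j < i + int (n * k) + int N \<Longrightarrow> y j = y' j"
  shows "marked n N rk y i = marked n N rk y' i"
  using assms
proof (induction k arbitrary: i)
  case 0
  have w: "win y i N = win y' i N" by (rule win_eqI) (use 0 in auto)
  show ?case using 0(1) is_per_cong(1)[OF w, of n]
    by (subst (1 2) marked.simps) (auto simp: w)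
next
  case (Suc k)
  have w: "win y j N = win y' j N" if "\<bar>j - i\<bar> \<le> int n" for j
  proof (rule win_eqI)
    fix l assume l: "j \<le> l" "l < j + int N"
    have "int n \<le> int (n * Suc k)" by (simp only: of_nat_le_iff) simp
    then show "y l = y' l" using that l by (intro Suc.prems(2)) linarith+
  qed
  have "marked n N rk y j = marked n N rk y' j"
    if j: "\<bar>j - i\<bar> < int n" "rk (win y j N) < rk (win y i N)" for j
  proof (rule Suc.IH)
    show "rk (win y j N) \<le> k" using j(2) Suc.prems(1) by simp
    fix l assume l: "j - int (n * k) \<le> l" "l < j + int (n * k) + int N"
    have "int (n * Suc k) = int n + int (n * k)" by simp
    then show "y l = y' l" using l j(1) by (intro Suc.prems(2)) linarith+
  qed
  moreover have "is_per n N y i = is_per n N y' i" by (rule is_per_cong(1)[OF w]) simp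
  ultimately show ?case
    by (subst (1 2) marked.simps) (use w in auto)
qed

lemma marked_translate: "marked n N rk (translate k y) i = marked n N rk y (i + k)"
proof (induction "rk (win y (i + k) N)" arbitrary: i rule: less_induct)
  case less
  have per: "is_per n N (translate k y) i = is_per n N y (i + k)"
    by (rule is_per_cong(1)) simp
  have IH: "marked n N rk (translate k y) j = marked n N rk y (j + k)"
    if "rk (win y (j + k) N) < rk (win y (i + k) N)" for j
    using less that by blast
  have "(\<forall>j\<in>{j. \<bar>j - i\<bar> < int n \<and> rk (win (translate k y) j N) < rk (win (translate k y) i N)}. \<not> marked n N rk (translate k y) j)
    \<longleftrightarrow> (\<forall>j\<in>{j. \<bar>j - (i + k)\<bar> < int n \<and> rk (win y j N) < rk (win y (i + k) N)}. \<not> marked n N rk y j)"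
    (is "?L \<longleftrightarrow> ?R")
  proof
    assume L: ?L
    show ?R
    proof
      fix j assume j: "j \<in> {j. \<bar>j - (i + k)\<bar> < int n \<and> rk (win y j N) < rk (win y (i + k) N)}"
      then have "\<not> marked n N rk (translate k y) (j - k)"
        using L by (auto simp: algebra_simps)
      then show "\<not> marked n N rk y j" using IH[of "j - k"] j by simp
    qed
  next
    assume R: ?R
    show ?L
    proof
      fix j assume j: "j \<in> {j. \<bar>j - i\<bar> < int n \<and> rk (win (translate k y) j N) < rk (win (translate k y) i N)}"
      then have "\<not> marked n N rk y (j + k)" using R by auto
      then show "\<not> marked n N rk (translate k y) j" using IH[of j] j by simp
    qed
  qed
  then show ?case using per
    by (subst (1 2) marked.simps) blast
qed

subsection \<open>Labelled paths\<close>

text \<open>In a finite semigroup the powers of an element become periodic; an exponent past the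
  preperiod and divisible by the period gives an idempotent power. The bounds depend on the number
  of relations only, so one \<open>m\<close> serves all \<open>T\<close>.\<close>

lemma relpow_idempotent_exponent:
  assumes V: "finite V"
  obtains m where "m \<ge> 1" "\<And>T. T \<subseteq> V \<times> V \<Longrightarrow> (T ^^ m) O (T ^^ m) = T ^^ m"
proof -
  define c where "c = card (Pow (V \<times> V))"
  \<comment> \<open>The factorial is divisible by every period up to \<open>c\<close> and exceeds
    every preperiod. The factor \<open>1\<close> fixes its type.\<close>
  define m where "m = fact (Suc c) * (1::nat)"
  have "(T ^^ m) O (T ^^ m) = T ^^ m" if T: "T \<subseteq> V \<times> V" for T
  proof -
    have sub: "T ^^ Suc k \<subseteq> V \<times> V" for k
      using T by (induction k) auto
    \<comment> \<open>Pigeonhole among positive powers: the power 0 is the identity on the whole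
      type and not a relation on \<open>V\<close>.\<close>
    have "\<not> inj_on (\<lambda>k. T ^^ Suc k) {0..c}"
    proof (rule pigeonhole)
      have "(\<lambda>k. T ^^ Suc k) ` {0..c} \<subseteq> Pow (V \<times> V)" using sub by blast
      then have "card ((\<lambda>k. T ^^ Suc k) ` {0..c}) \<le> c"
        unfolding c_def using V by (intro card_mono) auto
      then show "card ((\<lambda>k. T ^^ Suc k) ` {0..c}) < card {0..c}" by simp
    qed
    then obtain i0 j0 where "i0 \<le> c" "j0 \<le> c" "i0 \<noteq> j0" "T ^^ Suc i0 = T ^^ Suc j0"
      by (auto simp: inj_on_def)
    then obtain i j where ij: "i < j" "j \<le> c" "T ^^ Suc i = T ^^ Suc j"
      by (metis linorder_neqE_nat)
    define q where "q = j - i"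
    have q: "0 < q" "q \<le> c" "Suc j = Suc i + q" using ij by (auto simp: q_def)
    have step: "T ^^ (k + q) = T ^^ k" if "Suc i \<le> k" for k
    proof -
      have "T ^^ (k + q) = T ^^ (k - Suc i) O T ^^ (Suc i + q)"
        using that relpow_add[of "k - Suc i" "Suc i + q" T] by simp
      also have "\<dots> = T ^^ (k - Suc i) O T ^^ Suc i" using ij(3) q(3) by simp
      also have "\<dots> = T ^^ k" using that relpow_add[of "k - Suc i" "Suc i" T] by simp
      finally show ?thesis .
    qed
    have iter: "T ^^ (k + q * l) = T ^^ k" if "Suc i \<le> k" for k l
    proof (induction l)
      case (Suc l)
      have "T ^^ (k + q * l + q) = T ^^ (k + q * l)" using that by (intro step) simp
      then show ?case using Suc by (simp add: add.assoc add.commute[of q])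
    qed simp
    have "q dvd m" using q dvd_fact[of q "Suc c"] by (simp add: m_def)
    then obtain l where l: "m = q * l" by blast
    have "Suc i \<le> m"
    proof -
      have "Suc c \<le> fact (Suc c)" by (rule fact_ge_self)
      then show ?thesis using ij by (simp add: m_def)
    qed
    from iter[OF this, of l] have "T ^^ (m + m) = T ^^ m" by (simp flip: l)
    then show ?thesis by (simp add: relpow_add)
  qed
  moreover have "m \<ge> 1" unfolding m_def by (simp del: fact_Suc add: fact_ge_1)
  ultimately show ?thesis using that by blast
qed

section \<open>Relations of labelled paths along a label sequence\<close>

definition vertex_shift :: "('v \<times> 'v) set \<Rightarrow> (int \<Rightarrow> 'v) set" where
  "vertex_shift G = {s. \<forall>i. (s i, s (i + 1)) \<in> G}"

text \<open>The labels are prescribed on a half-open interval and the end vertex is free, so that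
  concatenation of paths is exactly relational composition.\<close>

definition conn :: "('v \<times> 'v) set \<Rightarrow> ('v \<Rightarrow> 'b) \<Rightarrow> (int \<Rightarrow> 'b) \<Rightarrow> int \<Rightarrow> nat \<Rightarrow> ('v \<times> 'v) set" where
  "conn G L y i k = {(a, b). \<exists>f. f i = a \<and> f (i + int k) = b \<and>
     (\<forall>t. i \<le> t \<and> t < i + int k \<longrightarrow> (f t, f (t + 1)) \<in> G \<and> L (f t) = y t)}"

lemma connI:
  assumes "f i = a" "f (i + int k) = b"
    and "\<And>t. i \<le> t \<Longrightarrow> t < i + int k \<Longrightarrow> (f t, f (t + 1)) \<in> G"
    and "\<And>t. i \<le> t \<Longrightarrow> t < i + int k \<Longrightarrow> L (f t) = y t"
  shows "(a, b) \<in> conn G L y i k"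
  using assms unfolding conn_def by blast

lemma connE:
  assumes "(a, b) \<in> conn G L y i k"
  obtains f where "f i = a" "f (i + int k) = b"
    "\<And>t. i \<le> t \<Longrightarrow> t < i + int k \<Longrightarrow> (f t, f (t + 1)) \<in> G"
    "\<And>t. i \<le> t \<Longrightarrow> t < i + int k \<Longrightarrow> L (f t) = y t"
  using assms unfolding conn_def by blast

lemma conn_0: "conn G L y i 0 = Id"
  unfolding conn_def by auto

lemma conn_add: "conn G L y i (k + l) = conn G L y i k O conn G L y (i + int k) l"
proof (intro equalityI subrelI)
  fix a b assume "(a, b) \<in> conn G L y i (k + l)"
  then obtain f where f: "f i = a" "f (i + int (k + l)) = b"
    "\<And>t. i \<le> t \<Longrightarrow> t < i + int (k + l) \<Longrightarrow> (f t, f (t + 1)) \<in> G"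
    "\<And>t. i \<le> t \<Longrightarrow> t < i + int (k + l) \<Longrightarrow> L (f t) = y t" by (rule connE) blast
  have "(a, f (i + int k)) \<in> conn G L y i k" by (rule connI[of f]) (use f in auto)
  moreover have "(f (i + int k), b) \<in> conn G L y (i + int k) l"
    by (rule connI[of f]) (use f in \<open>auto simp: algebra_simps\<close>)
  ultimately show "(a, b) \<in> conn G L y i k O conn G L y (i + int k) l" by blast
next
  fix a c assume "(a, c) \<in> conn G L y i k O conn G L y (i + int k) l"
  then obtain b where ab: "(a, b) \<in> conn G L y i k" and bc: "(b, c) \<in> conn G L y (i + int k) l" by blast
  obtain f where f: "f i = a" "f (i + int k) = b"
    "\<And>t. i \<le> t \<Longrightarrow> t < i + int k \<Longrightarrow> (f t, f (t + 1)) \<in> G"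
    "\<And>t. i \<le> t \<Longrightarrow> t < i + int k \<Longrightarrow> L (f t) = y t" using ab by (rule connE) blast
  obtain g where g: "g (i + int k) = b" "g (i + int k + int l) = c"
    "\<And>t. i + int k \<le> t \<Longrightarrow> t < i + int k + int l \<Longrightarrow> (g t, g (t + 1)) \<in> G"
    "\<And>t. i + int k \<le> t \<Longrightarrow> t < i + int k + int l \<Longrightarrow> L (g t) = y t" using bc by (rule connE) blast
  define h where "h t = (if t < i + int k then f t else g t)" for t
  have h: "h t = f t" if "t \<le> i + int k" for t
    using that f(2) g(1) by (cases "t = i + int k") (auto simp: h_def)
  have h': "h t = g t" if "i + int k \<le> t" for t using that by (auto simp: h_def)
  show "(a, c) \<in> conn G L y i (k + l)"
  proof (rule connI[of h])
    show "h i = a" using h f(1) by simp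
    show "h (i + int (k + l)) = c" using h' g(2) by (simp add: add.assoc)
    fix t assume t: "i \<le> t" "t < i + int (k + l)"
    show "(h t, h (t + 1)) \<in> G"
      using t f(3)[of t] g(3)[of t] h[of t] h[of "t + 1"] h'[of t] h'[of "t + 1"]
      by (cases "t < i + int k") auto
    show "L (h t) = y t"
      using t f(4)[of t] g(4)[of t] h[of t] h'[of t] by (cases "t < i + int k") auto
  qed
qed

lemma conn_shift:
  assumes "\<And>t. i \<le> t \<Longrightarrow> t < i + int k \<Longrightarrow> y' (t + d) = y t"
  shows "conn G L y i k \<subseteq> conn G L y' (i + d) k"
proof (rule subrelI)
  fix a b assume "(a, b) \<in> conn G L y i k"
  then obtain f where f: "f i = a" "f (i + int k) = b"
    "\<And>t. i \<le> t \<Longrightarrow> t < i + int k \<Longrightarrow> (f t, f (t + 1)) \<in> G"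
    "\<And>t. i \<le> t \<Longrightarrow> t < i + int k \<Longrightarrow> L (f t) = y t" by (rule connE) blast
  show "(a, b) \<in> conn G L y' (i + d) k"
  proof (rule connI[of "\<lambda>t. f (t - d)"])
    show "f (i + d - d) = a" "f (i + d + int k - d) = b" using f(1,2) by simp_all
    fix t assume t: "i + d \<le> t" "t < i + d + int k"
    show "(f (t - d), f (t + 1 - d)) \<in> G" using f(3)[of "t - d"] t by (simp add: algebra_simps)
    show "L (f (t - d)) = y' t" using f(4)[of "t - d"] assms[of "t - d"] t by simp
  qed
qed

lemma conn_cong:
  assumes "\<And>t. i \<le> t \<Longrightarrow> t < i + int k \<Longrightarrow> y' t = y t"
  shows "conn G L y i k = conn G L y' i k"
  using conn_shift[of i k y' 0 y G L] conn_shift[of i k y 0 y' G L] assms by auto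

lemma conn_translate: "conn G L (translate k y) i l = conn G L y (i + k) l"
proof
  show "conn G L (translate k y) i l \<subseteq> conn G L y (i + k) l"
    by (rule conn_shift) (simp add: translate_apply)
  show "conn G L y (i + k) l \<subseteq> conn G L (translate k y) i l"
    using conn_shift[of "i + k" l "translate k y" "- k" y G L] by (simp add: translate_apply)
qed

lemma conn_vertex_shift:
  assumes "s \<in> vertex_shift G" "\<And>t. i \<le> t \<Longrightarrow> t < i + int k \<Longrightarrow> L (s t) = y t"
  shows "(s i, s (i + int k)) \<in> conn G L y i k"
  by (rule connI[of s]) (use assms in \<open>auto simp: vertex_shift_def\<close>)

lemma conn_period:
  assumes per: "\<forall>t. y (t + int p) = y t"
  shows "conn G L y (i + int (p * l)) k = conn G L y i k"
proof -
  have it: "y (t + int (p * l)) = y t" for t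
  proof (induction l)
    case (Suc l)
    have "y (t + int (p * l) + int p) = y (t + int (p * l))" using per by blast
    moreover have "t + int (p * Suc l) = t + int (p * l) + int p" by simp
    ultimately show ?case using Suc by (simp only:)
  qed simp
  have "conn G L y i k \<subseteq> conn G L y (i + int (p * l)) k" by (rule conn_shift) (rule it)
  moreover have "conn G L y (i + int (p * l)) k \<subseteq> conn G L y (i + int (p * l) + - int (p * l)) k"
    by (rule conn_shift) (use it[of "t - int (p * l)" for t] in simp)
  ultimately show ?thesis by simp
qed

lemma conn_relpow:
  assumes per: "\<forall>t. y (t + int p) = y t"
  shows "conn G L y i (p * k) = conn G L y i p ^^ k"
proof (induction k)
  case (Suc k)
  have "conn G L y i (p * k + p) = conn G L y i (p * k) O conn G L y (i + int (p * k)) p"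
    by (rule conn_add)
  then show ?case using Suc conn_period[OF per, of G L i k p] by (simp add: add.commute)
qed (simp add: conn_0)

lemma conn_subset:
  assumes "G \<subseteq> V \<times> V" "0 < k"
  shows "conn G L y i k \<subseteq> V \<times> V"
proof (rule subrelI)
  fix a b assume "(a, b) \<in> conn G L y i k"
  then obtain f where f: "f i = a" "f (i + int k) = b"
    "\<And>t. i \<le> t \<Longrightarrow> t < i + int k \<Longrightarrow> (f t, f (t + 1)) \<in> G" by (rule connE) blast
  have "(f i, f (i + 1)) \<in> G" "(f (i + int k - 1), f (i + int k - 1 + 1)) \<in> G"
    using assms(2) by (intro f(3); simp)+
  then show "(a, b) \<in> V \<times> V" using f(1,2) assms(1) by auto
qed

text \<open>Reachability in \<open>p * m\<close> steps is the \<open>m\<close>-th power of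
  reachability in one period. Hence any positive number of such stretches can be shortened to one,
  and the relation is transitive.\<close>

lemma conn_idempotent:
  assumes per: "\<forall>t. y (t + int p) = y t" and G: "G \<subseteq> V \<times> V" and "0 < p"
    and idem: "\<And>T. T \<subseteq> V \<times> V \<Longrightarrow> (T ^^ m) O (T ^^ m) = T ^^ m" and "1 \<le> l"
  shows "conn G L y i (p * m * l) = conn G L y i (p * m)"
  using assms(5)
proof (induction l rule: dec_induct)
  case (step l)
  let ?T = "conn G L y i p"
  have T: "?T \<subseteq> V \<times> V" by (rule conn_subset[OF G assms(3)])
  have "conn G L y i (p * m * Suc l) = conn G L y i (p * m) O conn G L y (i + int (p * m)) (p * m * l)"
    using conn_add[of G L y i "p * m" "p * m * l"] by simp
  also have "\<dots> = conn G L y i (p * m) O conn G L y i (p * m)"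
    unfolding conn_period[OF per] step by simp
  also have "\<dots> = conn G L y i (p * m)"
    unfolding conn_relpow[OF per] by (rule idem[OF T])
  finally show ?case .
qed simp

text \<open>The relation need not be reflexive, so \<open>v\<close> is inserted: a vertex that lies
  on no closed walk forms a class of its own.\<close>

definition class_of :: "('v \<times> 'v) set \<Rightarrow> 'v \<Rightarrow> 'v set" where
  "class_of E v = insert v {w. (v, w) \<in> E \<and> (w, v) \<in> E}"

lemma class_of_eqI:
  assumes "E O E = E" "(v, w) \<in> E" "(w, v) \<in> E"
  shows "class_of E v = class_of E w"
proof -
  have tr: "(a, c) \<in> E" if "(a, b) \<in> E" "(b, c) \<in> E" for a b c using assms(1) that by blast
  show ?thesis using assms(2,3) unfolding class_of_def by (auto intro: tr)
qed

lemma class_of_eqD: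
  assumes "class_of E v = class_of E w"
  shows "v = w \<or> (v, w) \<in> E \<and> (w, v) \<in> E"
proof -
  have "w \<in> class_of E v" unfolding assms by (simp add: class_of_def)
  then show ?thesis by (auto simp: class_of_def)
qed

subsection \<open>Gluing partial preimages\<close>

text \<open>\<open>n\<close> is the marker distance, \<open>m\<close> the idempotent exponent,
  \<open>N\<close> the length of the windows searched for periods below \<open>n\<close>, and
  \<open>H\<close> bounds the ranks of label words. \<open>2 * n + 1 \<le> N\<close> lets
  neighbouring periodic windows share their least period; \<open>n * m \<le> N\<close> keeps
  \<open>m\<close> periods inside one window.\<close>

locale labelled_graph =
  fixes V :: "'v set" and G :: "('v \<times> 'v) set" and L :: "'v \<Rightarrow> 'b"
    and n N m H :: nat and rk :: "'b list \<Rightarrow> nat"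
  assumes finite_V: "finite V" and G_subset: "G \<subseteq> V \<times> V"
    and n_pos: "1 \<le> n" and m_pos: "1 \<le> m"
    and idem: "\<And>T. T \<subseteq> V \<times> V \<Longrightarrow> (T ^^ m) O (T ^^ m) = T ^^ m"
    and N_large: "2 * n + 1 \<le> N" "n * m \<le> N"
    and rk_inj: "inj_on rk {w. set w \<subseteq> L ` V \<and> length w = N}"
    and rk_bound: "\<And>w. set w \<subseteq> L ` V \<Longrightarrow> length w = N \<Longrightarrow> rk w \<le> H"
    and nonempty: "vertex_shift G \<noteq> {}"
begin

abbreviation P :: "(int \<Rightarrow> 'v) set" where
  "P \<equiv> vertex_shift G"

text \<open>The last alternative depends on the label alone and so costs no entropy. A set of
  vertices in all three cases gives the finite alphabet \<open>Pow V\<close>.\<close>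

definition block :: "(int \<Rightarrow> 'b) \<Rightarrow> int \<Rightarrow> 'v \<Rightarrow> 'v set" where
  "block y i v = (if marked n N rk y i then {v}
     else if is_per n N y i then class_of (conn G L y i (min_per N y i * m)) v
     else {w \<in> V. L w = y i})"

definition block_code :: "(int \<Rightarrow> 'v) \<Rightarrow> int \<Rightarrow> 'b \<times> 'v set" where
  "block_code s = (\<lambda>i. (L (s i), block (\<lambda>j. L (s j)) i (s i)))"

text \<open>The decision on a marker descends through at most \<open>H\<close> ranks by steps below
  \<open>n\<close> and reads a window of length \<open>N\<close> at each.\<close>

definition rad :: nat where
  "rad = n * H + N"

lemma P_edge: "s \<in> P \<Longrightarrow> (s i, s (i + 1)) \<in> G"
  by (simp add: vertex_shift_def)

lemma P_vertex: "s \<in> P \<Longrightarrow> s i \<in> V"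
  using P_edge[of s i] G_subset by auto

lemma P_translate: "s \<in> P \<Longrightarrow> translate k s \<in> P"
  using P_edge[of s "i + k" for i] by (auto simp: vertex_shift_def translate_apply algebra_simps)

lemma shift_space_P: "shift_space P"
  unfolding shift_space_iff
proof (intro conjI ballI allI)
  show "window_closed P" unfolding window_closed_def
  proof (intro allI impI)
    fix s assume s: "\<forall>k. \<exists>s'\<in>P. \<forall>j. \<bar>j\<bar> \<le> int k \<longrightarrow> s' j = s j"
    have "(s i, s (i + 1)) \<in> G" for i
    proof -
      obtain s' where s': "s' \<in> P" "\<forall>j. \<bar>j\<bar> \<le> int (nat (\<bar>i\<bar> + 1)) \<longrightarrow> s' j = s j"
        using spec[OF s, of "nat (\<bar>i\<bar> + 1)"] by (elim bexE)
      have "s' i = s i" "s' (i + 1) = s (i + 1)" by (intro s'(2)[rule_format]; simp)+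
      then show ?thesis using P_edge[OF s'(1), of i] by simp
    qed
    then show "s \<in> P" by (simp add: vertex_shift_def)
  qed
  show "\<exists>A. finite A \<and> P \<subseteq> full_shift A"
    using finite_V P_vertex by (intro exI[of _ V]) (auto simp: full_shift_def)
qed (use nonempty P_translate in auto)

lemma min_per_mult_le:
  assumes "is_per n N y i"
  shows "0 < min_per N y i * m" "min_per N y i * m \<le> N"
proof -
  show "0 < min_per N y i * m" using min_per(1)[OF assms] m_pos by simp
  have "min_per N y i * m \<le> n * m" using min_per(2)[OF assms] by (intro mult_le_mono1) simp
  then show "min_per N y i * m \<le> N" using N_large(2) by (rule order_trans)
qed

lemma block_cong:
  assumes eq: "\<And>j. \<bar>j - i\<bar> \<le> int rad \<Longrightarrow> y j = y' j" and y: "\<And>j. \<bar>j - i\<bar> \<le> int rad \<Longrightarrow> y j \<in> L ` V"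
  shows "block y i v = block y' i v"
proof -
  have w: "win y i N = win y' i N" by (rule win_eqI) (use eq in \<open>auto simp: rad_def simp del: of_nat_mult\<close>)
  have "set (win y i N) \<subseteq> L ` V" using y by (auto simp: win_def rad_def simp del: of_nat_mult)
  then have "rk (win y i N) \<le> H" by (intro rk_bound) auto
  then have 1: "marked n N rk y i = marked n N rk y' i"
    by (rule marked_local) (use eq in \<open>auto simp: rad_def simp del: of_nat_mult\<close>)
  note 2 = is_per_cong(1)[OF w, of n] is_per_cong(2)[OF w]
  have 3: "conn G L y i (min_per N y i * m) = conn G L y' i (min_per N y i * m)" if "is_per n N y i"
    by (rule conn_cong) (use eq min_per_mult_le[OF that] in \<open>auto simp: rad_def simp del: of_nat_mult\<close>)
  have "y i = y' i" by (rule eq) simp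
  then show ?thesis unfolding block_def using 1 2 3 by auto
qed

lemma block_translate: "block (translate k y) i v = block y (i + k) v"
proof -
  have "is_per n N (translate k y) i = is_per n N y (i + k)"
    "min_per N (translate k y) i = min_per N y (i + k)"
    by (rule is_per_cong, simp)+
  then show ?thesis
    by (simp add: block_def marked_translate conn_translate translate_apply)
qed

lemma local_code_block_code: "local_code P rad block_code"
  unfolding local_code_def
proof (intro conjI ballI allI impI)
  fix s k
  have "(\<lambda>j. L (translate k s j)) = translate k (\<lambda>j. L (s j))" by (simp add: translate_def)
  then show "block_code (translate k s) = translate k (block_code s)"
    unfolding block_code_def by (simp add: block_translate) (simp add: translate_def)
next
  fix s s' assume s: "s \<in> P" "s' \<in> P" "\<forall>j. \<bar>j\<bar> \<le> int rad \<longrightarrow> s j = s' j"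
  have "s 0 = s' 0" using s(3) by simp
  moreover have "block (\<lambda>j. L (s j)) 0 v = block (\<lambda>j. L (s' j)) 0 v" for v
    by (rule block_cong) (use s P_vertex in auto)
  ultimately show "block_code s 0 = block_code s' 0" by (simp add: block_code_def)
qed

lemma block_subset: "s \<in> P \<Longrightarrow> block y i (s i) \<subseteq> V"
proof -
  assume s: "s \<in> P"
  have "conn G L y i (min_per N y i * m) \<subseteq> V \<times> V" if "is_per n N y i"
    by (rule conn_subset[OF G_subset min_per_mult_le(1)[OF that]])
  then show ?thesis using P_vertex[OF s, of i] by (auto simp: block_def class_of_def)
qed

lemma block_code_alphabet: "s \<in> P \<Longrightarrow> block_code s i \<in> L ` V \<times> Pow V"
  using P_vertex[of s i] block_subset[of s] by (auto simp: block_code_def)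

lemma shift_space_block_code: "shift_space (block_code ` P)"
  by (rule shift_space_image[OF local_code_block_code shift_space_P, of "L ` V \<times> Pow V"])
    (use finite_V block_code_alphabet in auto)

text \<open>On a run of periodic positions the label sequence is continued to a periodic one, so that path
  relations are invariant under translation by the period.\<close>

lemma run_periodic_continuation:
  assumes per: "\<And>t. a \<le> t \<Longrightarrow> t \<le> b \<Longrightarrow> is_per n N y t" and "a \<le> b"
    and run: "periodic_on y a (b + int N) (int p)"
    and minp: "\<And>t. a \<le> t \<Longrightarrow> t \<le> b \<Longrightarrow> min_per N y t = p"
  obtains y' where "\<forall>t. y' (t + int p) = y' t" "\<And>t. a \<le> t \<Longrightarrow> t < b + int N \<Longrightarrow> y' t = y t"
    and "\<And>t. a \<le> t \<Longrightarrow> t \<le> b \<Longrightarrow> conn G L y t (min_per N y t * m) = conn G L y' t (p * m)"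
proof -
  have p: "0 < p" "p < n" using min_per(1,2)[OF per[of a]] minp[of a] assms(2) by auto
  define y' where "y' t = y (a + (t - a) mod int p)" for t
  have eq: "y' t = y t" if t: "a \<le> t" "t < b + int N" for t
  proof -
    define k where "k = nat ((t - a) div int p)"
    have k: "int k = (t - a) div int p" using t p by (simp add: k_def pos_imp_zdiv_nonneg_iff)
    have t': "a + (t - a) mod int p + int k * int p = t" unfolding k by simp
    have "y (a + (t - a) mod int p + int k * int p) = y (a + (t - a) mod int p)"
      by (rule periodic_on_iterate[OF run]) (use t t' p in auto)
    then show ?thesis unfolding t' y'_def by simp
  qed
  have "y' (t + int p) = y' t" for t
  proof -
    have "(t + int p - a) mod int p = (t - a) mod int p"
      by (metis add_diff_eq diff_add_eq mod_add_self2)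
    then show ?thesis by (simp add: y'_def)
  qed
  moreover have "conn G L y t (min_per N y t * m) = conn G L y' t (p * m)" if t: "a \<le> t" "t \<le> b" for t
    unfolding minp[OF t]
    by (rule conn_cong, rule eq) (use t min_per_mult_le[OF per[OF t]] minp[OF t] in \<open>auto simp del: of_nat_mult\<close>)
  ultimately show ?thesis using that eq by blast
qed

text \<open>Partial preimages. The block is computed from the labels in \<open>z\<close> and not
  from those of \<open>s\<close>, because markers and periods at \<open>t\<close> may depend on
  positions outside the interval, where \<open>s\<close> is arbitrary.\<close>

definition agrees :: "(int \<Rightarrow> 'b \<times> 'v set) \<Rightarrow> (int \<Rightarrow> 'v) \<Rightarrow> int \<Rightarrow> int \<Rightarrow> bool" where
  "agrees z s lo hi \<longleftrightarrow> (\<forall>t. lo \<le> t \<and> t \<le> hi \<longrightarrow>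
     L (s t) = fst (z t) \<and> block (\<lambda>j. fst (z j)) t (s t) = snd (z t))"

text \<open>Cutting off \<open>n\<close> positions at either end of a marker-free interval leaves
  only periodic positions; what remains has room for \<open>card V + 1\<close> stretches of
  \<open>m\<close> periods.\<close>

definition glue_length :: int where
  "glue_length = 2 * int n + int (n * m * (card V + 1))"

lemma agreesD:
  assumes "agrees z s lo hi" "lo \<le> t" "t \<le> hi"
  shows "L (s t) = fst (z t)" "block (\<lambda>j. fst (z j)) t (s t) = snd (z t)"
  using assms by (auto simp: agrees_def)

lemma agrees_subset: "agrees z s lo hi \<Longrightarrow> lo \<le> lo' \<Longrightarrow> hi' \<le> hi \<Longrightarrow> agrees z s lo' hi'"
  by (auto simp: agrees_def)

lemma splice:
  assumes s: "s \<in> P" "s' \<in> P" and f: "f a = s a" "f (a + int q) = s' (a + int q)"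
    and G: "\<And>t. a \<le> t \<Longrightarrow> t < a + int q \<Longrightarrow> (f t, f (t + 1)) \<in> G"
  shows "(\<lambda>t. if t \<le> a then s t else if t < a + int q then f t else s' t) \<in> P" (is "?h \<in> P")
proof -
  have h1: "?h t = s t" if "t \<le> a" for t using that by simp
  have h2: "?h t = f t" if "a \<le> t" "t \<le> a + int q" for t
    using that f by (cases "t = a"; cases "t = a + int q") auto
  have h3: "?h t = s' t" if "a + int q \<le> t" for t
    using that f by (cases "t = a") auto
  have "(?h t, ?h (t + 1)) \<in> G" for t
  proof -
    consider "t < a" | "a \<le> t" "t < a + int q" | "a + int q \<le> t" by linarith
    then show ?thesis
    proof cases
      case 1
      then show ?thesis using h1[of t] h1[of "t + 1"] P_edge[OF s(1), of t] by simp
    next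
      case 2
      have "?h t = f t" "?h (t + 1) = f (t + 1)" by (rule h2; use 2 in linarith)+
      then show ?thesis using G[OF 2] by simp
    next
      case 3
      have "?h t = s' t" "?h (t + 1) = s' (t + 1)" using h3[of t] h3[of "t + 1"] 3 by auto
      then show ?thesis using P_edge[OF s(2), of t] by simp
    qed
  qed
  then show ?thesis by (simp add: vertex_shift_def)
qed

text \<open>Among the vertices at distances \<open>p * m\<close> some vertex repeats, say first at
  \<open>j\<close>. The walk from \<open>j + p * m\<close> to the repetition is a multiple of
  \<open>p * m\<close> long; idempotence shortens it to a single stretch, unless it is
  empty.\<close>

lemma recurrence_on_run:
  assumes s: "s \<in> P" and y': "\<forall>t. y' (t + int p) = y' t" and p: "0 < p"
    and lab: "\<And>t. a \<le> t \<Longrightarrow> t < a + int (p * m * (card V + 1)) \<Longrightarrow> L (s t) = y' t"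
  obtains j where "a \<le> j" "j + int (p * m) \<le> a + int (p * m * (card V + 1))"
    "s (j + int (p * m)) = s j \<or> (s (j + int (p * m)), s j) \<in> conn G L y' j (p * m)"
proof -
  let ?q = "p * m"
  have "\<not> inj_on (\<lambda>k. s (a + int (?q * k))) {0..card V}"
  proof (rule pigeonhole)
    have "card ((\<lambda>k. s (a + int (?q * k))) ` {0..card V}) \<le> card V"
      using finite_V P_vertex[OF s] by (intro card_mono) auto
    then show "card ((\<lambda>k. s (a + int (?q * k))) ` {0..card V}) < card {0..card V}" by simp
  qed
  then obtain k0 l0 where "k0 \<le> card V" "l0 \<le> card V" "k0 \<noteq> l0" "s (a + int (?q * k0)) = s (a + int (?q * l0))"
    by (auto simp: inj_on_def)
  then obtain k l where kl: "k < l" "l \<le> card V" "s (a + int (?q * k)) = s (a + int (?q * l))"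
    by (metis linorder_neqE_nat)
  define j where "j = a + int (?q * k)"
  define d where "d = l - k - 1"
  have l: "l = k + 1 + d" using kl by (simp add: d_def)
  have jl: "a + int (?q * l) = j + int ?q + int (?q * d)" by (simp add: j_def l algebra_simps)
  have "?q * l \<le> ?q * (card V + 1)" using kl by (intro mult_le_mono2) simp
  then have le: "a + int (?q * l) \<le> a + int (?q * (card V + 1))" by (simp only: of_nat_le_iff add_le_cancel_left)
  have "(s (j + int ?q), s (j + int ?q + int (?q * d))) \<in> conn G L y' (j + int ?q) (?q * d)"
    by (rule conn_vertex_shift[OF s]) (rule lab; use le jl j_def in linarith)
  then have "(s (j + int ?q), s j) \<in> conn G L y' (j + int ?q) (?q * d)"
    using kl(3) unfolding jl j_def[symmetric] by simp
  then have "(s (j + int ?q), s j) \<in> conn G L y' j (?q * d)"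
    unfolding conn_period[OF y'] .
  then have "s (j + int ?q) = s j \<or> (s (j + int ?q), s j) \<in> conn G L y' j ?q"
    using conn_idempotent[OF y' G_subset p idem, of d L j] conn_0[of G L y' j]
    by (cases "d = 0") auto
  moreover have "0 \<le> int (?q * k)" "0 \<le> int (?q * d)" by simp_all
  then have "a \<le> j" "j + int ?q \<le> a + int (?q * (card V + 1))" using le jl unfolding j_def by linarith+
  ultimately show ?thesis using that by blast
qed

text \<open>At a marker the two walks pass through the same vertex. Without a marker the interval
  contains a periodic run, and the change from \<open>s\<close> to \<open>s'\<close> takes place
  during one stretch of \<open>m\<close> periods chosen by \<open>recurrence_on_run\<close>.\<close>

lemma glue:
  assumes s: "s \<in> P" "agrees z s lo hi" and s': "s' \<in> P" "agrees z s' lo hi"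
    and hi: "lo + glue_length \<le> hi"
  obtains s'' where "s'' \<in> P" "\<And>t. t \<le> lo \<Longrightarrow> s'' t = s t" "\<And>t. hi \<le> t \<Longrightarrow> s'' t = s' t"
    "agrees z s'' lo hi"
proof (cases "\<exists>j. lo \<le> j \<and> j \<le> hi \<and> marked n N rk (\<lambda>j. fst (z j)) j")
  case True
  then obtain j where j: "lo \<le> j" "j \<le> hi" "marked n N rk (\<lambda>j. fst (z j)) j" by blast
  have "{s j} = {s' j}"
    using agreesD(2)[OF s(2) j(1,2)] agreesD(2)[OF s'(2) j(1,2)] j(3) by (simp add: block_def)
  then have eq: "s j = s' j" by simp
  let ?h = "\<lambda>t. if t \<le> j then s t else if t < j + int 0 then s t else s' t"
  have "?h \<in> P" by (rule splice[OF s(1) s'(1)]) (use eq in auto)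
  moreover have "agrees z ?h lo hi" using s(2) s'(2) by (auto simp: agrees_def)
  moreover have "?h t = s' t" if "hi \<le> t" for t
    using that j eq by (cases "t = j") auto
  ultimately show ?thesis by (intro that[of ?h]) (use j in auto)
next
  case False
  define y where "y = (\<lambda>j. fst (z j))"
  define a where "a = lo + int n"
  define l where "l = n * m * (card V + 1)"
  have al: "a + int l \<le> hi - int n" using hi by (simp add: a_def l_def glue_length_def)
  \<comment> \<open>Otherwise a marker lies within distance \<open>n\<close>, and the margins of
    length \<open>n\<close> would place it between \<open>lo\<close> and \<open>hi\<close>.\<close>
  have per: "is_per n N y t" if "a \<le> t" "t \<le> a + int l" for t
  proof (rule ccontr)
    assume "\<not> is_per n N y t"
    then obtain j where "\<bar>j - t\<bar> < int n" "marked n N rk y j" using marked_dense n_pos by blast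
    then show False using False that al by (auto simp: a_def y_def)
  qed
  define p where "p = min_per N y a"
  have p: "0 < p" "p < n" using min_per(1,2)[OF per[of a]] by (auto simp: p_def)
  have minp: "min_per N y t = p" if "a \<le> t" "t \<le> a + int l" for t
    using per_interval[of a "nat (t - a)" n N y] per N_large(1) that by (auto simp: p_def)
  have run: "periodic_on y a (a + int l + int N) (int p)"
    using per_interval[of a l n N y] per N_large(1) by (auto simp: p_def)
  obtain y' where y': "\<forall>t. y' (t + int p) = y' t" "\<And>t. a \<le> t \<Longrightarrow> t < a + int l + int N \<Longrightarrow> y' t = y t"
    and E: "\<And>t. a \<le> t \<Longrightarrow> t \<le> a + int l \<Longrightarrow> conn G L y t (min_per N y t * m) = conn G L y' t (p * m)"
    using run_periodic_continuation[OF per _ run minp] by auto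
  let ?q = "p * m"
  let ?E = "\<lambda>t. conn G L y' t ?q"
  have block: "block y t v = class_of (?E t) v" if "a \<le> t" "t \<le> a + int l" for t v
    using False per[OF that] E[OF that] that al by (auto simp: block_def y_def a_def)
  have lab: "L (s t) = y' t" "L (s' t) = y' t" if "a \<le> t" "t \<le> a + int l" for t
    using agreesD(1)[OF s(2), of t] agreesD(1)[OF s'(2), of t] y'(2)[of t] that al N_large
    by (auto simp: y_def a_def)
  have "?q * (card V + 1) \<le> l" unfolding l_def using p by (intro mult_le_mono) auto
  then have ql: "int (?q * (card V + 1)) \<le> int l" by (simp only: of_nat_le_iff)
  have lab': "L (s t) = y' t" if "a \<le> t" "t < a + int (?q * (card V + 1))" for t
    by (rule lab(1)) (use that ql in linarith)+
  obtain j where j: "a \<le> j" "j + int ?q \<le> a + int (?q * (card V + 1))"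
    and ret: "s (j + int ?q) = s j \<or> (s (j + int ?q), s j) \<in> ?E j"
    by (rule recurrence_on_run[OF s(1) y'(1) p(1) lab', of a])
  have jl: "j + int ?q \<le> a + int l" using j(2) ql by linarith
  have q_pos: "0 < ?q" using p m_pos by simp
  have jq: "conn G L y' (j + int ?q) k = conn G L y' j k" for k
    using conn_period[OF y'(1), of G L j m k] by simp
  have comp: "?E t O ?E t = ?E t" for t
    using conn_idempotent[OF y'(1) G_subset p(1) idem, of 2 L t] conn_add[of G L y' t ?q ?q]
      conn_period[OF y'(1), of G L t m ?q] by (simp add: mult_2_right)
  have tr: "(u, w) \<in> ?E t" if "(u, v) \<in> ?E t" "(v, w) \<in> ?E t" for t u v w
    using comp[of t] that by blast
  have sj: "(s j, s (j + int ?q)) \<in> ?E j"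
    by (rule conn_vertex_shift[OF s(1)]) (rule lab(1); use j jl in linarith)
  have "class_of (?E j) (s (j + int ?q)) = class_of (?E j) (s' (j + int ?q))"
  proof -
    have bd: "a \<le> j + int ?q" "lo \<le> j + int ?q" "j + int ?q \<le> hi"
      using j(1) jl al unfolding a_def by linarith+
    show ?thesis
      using agreesD(2)[OF s(2) bd(2,3)] agreesD(2)[OF s'(2) bd(2,3)] block[OF bd(1) jl]
      unfolding y_def[symmetric] jq by simp
  qed
  from class_of_eqD[OF this]
  have ss': "s (j + int ?q) = s' (j + int ?q) \<or>
      (s (j + int ?q), s' (j + int ?q)) \<in> ?E j \<and> (s' (j + int ?q), s (j + int ?q)) \<in> ?E j" .
  \<comment> \<open>After one stretch along \<open>s\<close>, a second stretch inside the common
    class leads to \<open>s'\<close>, unless it is reached already; by transitivity one stretch is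
    enough for both.\<close>
  then have forth': "(s j, s' (j + int ?q)) \<in> ?E j" using sj tr by metis
  have ret': "s' (j + int ?q) = s j \<or> (s' (j + int ?q), s j) \<in> ?E j"
    using ss' ret tr by metis
  obtain f where f: "f j = s j" "f (j + int ?q) = s' (j + int ?q)"
    "\<And>t. j \<le> t \<Longrightarrow> t < j + int ?q \<Longrightarrow> (f t, f (t + 1)) \<in> G"
    "\<And>t. j \<le> t \<Longrightarrow> t < j + int ?q \<Longrightarrow> L (f t) = y' t"
    using forth' by (rule connE) blast
  let ?h = "\<lambda>t. if t \<le> j then s t else if t < j + int ?q then f t else s' t"
  have "?h \<in> P" by (rule splice[OF s(1) s'(1)]) (use f in auto)
  moreover have "agrees z ?h lo hi"
    unfolding agrees_def
  proof (intro allI impI, elim conjE)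
    fix t assume t: "lo \<le> t" "t \<le> hi"
    show "L (?h t) = fst (z t) \<and> block (\<lambda>j. fst (z j)) t (?h t) = snd (z t)"
    proof (cases "j < t \<and> t < j + int ?q")
      case False
      then show ?thesis using agreesD[OF s(2) t] agreesD[OF s'(2) t] by auto
    next
      case True
      then have h: "?h t = f t" and tr': "a \<le> t" "t \<le> a + int l" using j jl by auto
      define k where "k = nat (t - j)"
      define k' where "k' = ?q - k"
      have k: "int k = t - j" using True by (simp add: k_def)
      then have "int k \<le> int ?q" using True by linarith
      then have kq: "k \<le> ?q" by (simp only: of_nat_le_iff)
      then have "int k' = int ?q - int k" unfolding k'_def by (rule of_nat_diff)
      then have t': "t = j + int k" "t + int k' = j + int ?q" "k + k' = ?q"
        using k kq by (auto simp: k'_def)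
      \<comment> \<open>From \<open>t\<close> forward to \<open>j + p * m\<close>, back to the
        vertex at time \<open>j\<close> by at most one stretch, and forward again to the phase of
        \<open>t\<close>: one or two stretches in all, and two shorten to one. Periodicity
        identifies the times \<open>j\<close> and \<open>j + p * m\<close>.\<close>
      have loop: "(u, v) \<in> ?E t" if u: "(u, w) \<in> conn G L y' t k'" and w: "w = x \<or> (w, x) \<in> ?E j"
        and v: "(x, v) \<in> conn G L y' j k" for u v w x
      proof -
        have 1: "?E t = conn G L y' t k' O conn G L y' j k"
          using conn_add[of G L y' t k' k] unfolding t'(2) jq add.commute[of k' k] t'(3) .
        have 2: "?E j O conn G L y' j k = conn G L y' j (?q + k)"
          using conn_add[of G L y' j ?q k] jq[of k] by simp
        have 3: "conn G L y' t k' O conn G L y' j (?q + k) = conn G L y' t (?q * 2)"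
        proof -
          have two: "k' + (?q + k) = ?q * 2" using t'(3) by linarith
          show ?thesis using conn_add[of G L y' t k' "?q + k"] unfolding t'(2) jq two by (rule sym)
        qed
        have 4: "conn G L y' t (?q * 2) = ?E t"
          using conn_idempotent[OF y'(1) G_subset p(1) idem, of 2 L t] by simp
        show ?thesis using w
        proof
          assume "w = x"
          then show ?thesis using u v unfolding 1 by blast
        next
          assume "(w, x) \<in> ?E j"
          then have "(w, v) \<in> conn G L y' j (?q + k)" using v unfolding 2[symmetric] by blast
          then have "(u, v) \<in> conn G L y' t (?q * 2)" using u unfolding 3[symmetric] by blast
          then show ?thesis unfolding 4 .
        qed
      qed
      have in_run: "a \<le> x" "x \<le> a + int l" if "j \<le> x" "x \<le> j + int ?q" for x
        using that j jl by auto
      have s_k: "(s j, s t) \<in> conn G L y' j k"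
        unfolding t'(1) by (rule conn_vertex_shift[OF s(1)]) (rule lab(1)[OF in_run]; use t' in linarith)
      have s_k': "(s t, s (j + int ?q)) \<in> conn G L y' t k'"
        unfolding t'(2)[symmetric]
        by (rule conn_vertex_shift[OF s(1)]) (rule lab(1)[OF in_run]; use t' in linarith)
      have f_k: "(s j, f t) \<in> conn G L y' j k"
        by (rule connI[of f]) (fact f(1), simp only: t'(1)[symmetric],
          (rule f(3,4); use t'(1) True in linarith)+)
      have f_k': "(f t, s' (j + int ?q)) \<in> conn G L y' t k'"
        by (rule connI[of f]) (rule refl, simp only: t'(2) f(2),
          (rule f(3,4); use t'(2) True in linarith)+)
      \<comment> \<open>The closed walk runs from \<open>f t\<close> through
        \<open>s' (j + p * m)\<close> and \<open>s j\<close> to \<open>s t\<close>, then through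
        \<open>s (j + p * m)\<close> and \<open>s j\<close> back to \<open>f t\<close>. So the
        transition shows the class that \<open>z\<close> prescribes.\<close>
      have "class_of (?E t) (f t) = class_of (?E t) (s t)"
        by (rule class_of_eqI[OF comp loop[OF f_k' ret' s_k] loop[OF s_k' ret f_k]])
      then have "block y t (f t) = block y t (s t)" using block[OF tr'] by simp
      moreover have "L (f t) = y t" using f(4)[of t] True y'(2)[of t] tr' N_large by simp
      ultimately show ?thesis unfolding h using agreesD(2)[OF s(2) t] by (simp add: y_def)
    qed
  qed
  moreover have "?h t = s t" if "t \<le> lo" for t
    using that j(1) by (simp add: a_def)
  moreover have "?h t = s' t" if "hi \<le> t" for t
  proof -
    have "0 < int ?q" using q_pos by (simp only: of_nat_0_less_iff)
    then have "\<not> t \<le> j" "\<not> t < j + int ?q" using that jl al by linarith+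
    then show ?thesis by simp
  qed
  ultimately show ?thesis by (intro that[of ?h])
qed

text \<open>Each further local preimage overlaps the preimage built so far in exactly
  \<open>glue_length\<close>, and adds one position on the right.\<close>

lemma agrees_chain:
  assumes loc: "\<And>i. \<exists>s\<in>P. agrees z s i (i + glue_length + 1)"
  shows "\<exists>s\<in>P. agrees z s i (i + glue_length + 1 + int k)"
proof (induction k)
  case 0
  then show ?case using loc by simp
next
  case (Suc k)
  have glue0: "0 \<le> glue_length" by (simp add: glue_length_def)
  from Suc obtain s where s: "s \<in> P" "agrees z s i (i + glue_length + 1 + int k)" by blast
  let ?lo = "i + int k + 1"
  let ?hi = "?lo + glue_length"
  obtain r where r: "r \<in> P" "agrees z r ?lo (?hi + 1)" using loc by blast
  have "agrees z s ?lo ?hi" "agrees z r ?lo ?hi"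
    by (rule agrees_subset[OF s(2)], auto) (rule agrees_subset[OF r(2)], auto)
  then obtain s' where s': "s' \<in> P" "\<And>t. t \<le> ?lo \<Longrightarrow> s' t = s t" "\<And>t. ?hi \<le> t \<Longrightarrow> s' t = r t"
    "agrees z s' ?lo ?hi"
    using glue[OF s(1) _ r(1), of z ?lo ?hi] by blast
  have "agrees z s' i (i + glue_length + 1 + int (Suc k))"
    unfolding agrees_def
  proof (intro allI impI, elim conjE)
    fix t assume t: "i \<le> t" "t \<le> i + glue_length + 1 + int (Suc k)"
    consider "t < ?lo" | "?lo \<le> t" "t \<le> ?hi" | "?hi < t" by linarith
    then show "L (s' t) = fst (z t) \<and> block (\<lambda>j. fst (z j)) t (s' t) = snd (z t)"
    proof cases
      case 1
      then show ?thesis using s'(2)[of t] agreesD[OF s(2), of t] t glue0 by simp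
    next
      case 2
      then show ?thesis using agreesD[OF s'(4), of t] by simp
    next
      case 3
      then show ?thesis using s'(3)[of t] agreesD[OF r(2), of t] t glue0 by simp
    qed
  qed
  then show ?case using s'(1) by blast
qed

text \<open>Windows with a margin of \<open>rad\<close> yield local preimages, since there the
  markers and periods of \<open>s\<close> are those of \<open>z\<close>. Chaining gives preimages on
  arbitrarily long intervals, and closedness of the image does the rest.\<close>

lemma finite_type_block_code: "finite_type (block_code ` P)"
proof (rule finite_typeI[OF shift_space_block_code])
  \<comment> \<open>The number of positions from \<open>i - int rad\<close> to
    \<open>i + glue_length + 1 + int rad\<close>.\<close>
  let ?M = "nat (glue_length + 2 + 2 * int rad)"
  fix z assume z: "\<And>i. win z i ?M \<in> words ?M (block_code ` P)"
  have glue0: "0 \<le> glue_length" by (simp add: glue_length_def)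
  have ex: "\<exists>s\<in>P. \<forall>t. i - int rad \<le> t \<and> t \<le> i + glue_length + 1 + int rad \<longrightarrow> block_code s t = z t" for i
  proof -
    have "win z (i - int rad) ?M \<in> (\<lambda>x. win x (i - int rad) ?M) ` block_code ` P"
      using z words_eq_0[OF shift_space_block_code] by blast
    then obtain s where s: "s \<in> P" "win (block_code s) (i - int rad) ?M = win z (i - int rad) ?M" by auto
    have "block_code s t = z t" if "i - int rad \<le> t" "t \<le> i + glue_length + 1 + int rad" for t
      by (rule win_eqD[OF s(2)]) (use that glue0 in auto)
    then show ?thesis using s(1) by blast
  qed
  have lab: "fst (z i) \<in> L ` V" for i
  proof -
    obtain s where "s \<in> P" "block_code s i = z i" using ex[of i] glue0 by force
    then have "fst (z i) = L (s i)" "s i \<in> V"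
      using P_vertex by (simp_all add: block_code_def flip: \<open>block_code s i = z i\<close>)
    then show ?thesis by simp
  qed
  have loc: "\<exists>s\<in>P. agrees z s i (i + glue_length + 1)" for i
  proof -
    obtain s where s: "s \<in> P"
      "\<forall>t. i - int rad \<le> t \<and> t \<le> i + glue_length + 1 + int rad \<longrightarrow> block_code s t = z t"
      using ex by blast
    have sz: "L (s t) = fst (z t)" "block (\<lambda>j. L (s j)) t (s t) = snd (z t)"
      if "i - int rad \<le> t" "t \<le> i + glue_length + 1 + int rad" for t
      using s(2)[rule_format, of t] that by (auto simp: block_code_def prod_eq_iff)
    have "block (\<lambda>j. fst (z j)) t (s t) = snd (z t)" if t: "i \<le> t" "t \<le> i + glue_length + 1" for t
    proof -
      have "block (\<lambda>j. fst (z j)) t (s t) = block (\<lambda>j. L (s j)) t (s t)"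
        by (rule block_cong) (use t sz(1) lab in auto)
      then show ?thesis using sz(2)[of t] t by simp
    qed
    then have "agrees z s i (i + glue_length + 1)" unfolding agrees_def using sz(1) by simp
    then show ?thesis using s(1) by blast
  qed
  have "\<exists>z'\<in>block_code ` P. \<forall>j. \<bar>j\<bar> \<le> int k \<longrightarrow> z' j = z j" for k
  proof -
    let ?i = "- int k - int rad"
    obtain s where s: "s \<in> P" "agrees z s ?i (?i + glue_length + 1 + int (2 * k + 2 * rad))"
      using agrees_chain[OF loc] by blast
    have "block_code s j = z j" if j: "\<bar>j\<bar> \<le> int k" for j
    proof -
      have at: "L (s t) = fst (z t)" "block (\<lambda>j. fst (z j)) t (s t) = snd (z t)" if "\<bar>t - j\<bar> \<le> int rad" for t
        using agreesD[OF s(2), of t] that j glue0 by auto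
      have "block (\<lambda>j. L (s j)) j (s j) = block (\<lambda>j. fst (z j)) j (s j)"
        by (rule block_cong) (use at(1) lab in auto)
      then show ?thesis using at[of j] by (simp add: block_code_def prod_eq_iff)
    qed
    then show ?thesis using s(1) by blast
  qed
  then show "z \<in> block_code ` P"
    using shift_spaceD(3)[OF shift_space_block_code] unfolding window_closed_def by blast
qed

end

subsection \<open>Counting blocks\<close>

text \<open>Such a set is built in \<open>d\<close> rounds, each adding an element of
  \<open>A\<close> or nothing.\<close>

lemma card_bounded_subsets:
  assumes "finite A"
  shows "card {S. S \<subseteq> A \<and> card S \<le> d} \<le> (card A + 1) ^ d"
proof (induction d)
  case 0
  have "{S. S \<subseteq> A \<and> card S \<le> 0} \<subseteq> {{}}"
    using assms finite_subset by fastforce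
  then show ?case using card_mono[of "{{}}" "{S. S \<subseteq> A \<and> card S \<le> 0}"] by simp
next
  case (Suc d)
  let ?F = "\<lambda>d. {S. S \<subseteq> A \<and> card S \<le> d}"
  let ?ins = "\<lambda>(a, S). case a of None \<Rightarrow> S | Some x \<Rightarrow> insert x S"
  have fin: "finite (?F d)" for d using assms by simp
  have "?F (Suc d) \<subseteq> ?ins ` (insert None (Some ` A) \<times> ?F d)"
  proof
    fix S assume S: "S \<in> ?F (Suc d)"
    show "S \<in> ?ins ` (insert None (Some ` A) \<times> ?F d)"
    proof (cases "S = {}")
      case True
      then show ?thesis by (intro image_eqI[of _ _ "(None, {})"]) auto
    next
      case False
      then obtain x where x: "x \<in> S" by blast
      have "finite S" using S assms finite_subset by blast
      then have "card (S - {x}) \<le> d" using S card_Diff_singleton[OF x] by auto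
      then show ?thesis using S x by (intro image_eqI[of _ _ "(Some x, S - {x})"]) auto
    qed
  qed
  then have "card (?F (Suc d)) \<le> card (insert None (Some ` A) \<times> ?F d)"
    using assms fin by (meson card_image_le card_mono finite_SigmaI finite_imageI finite_insert order_trans)
  also have "\<dots> = (card A + 1) * card (?F d)"
    using assms by (simp add: card_cartesian_product card_image)
  also have "\<dots> \<le> (card A + 1) * (card A + 1) ^ d" by (intro mult_le_mono2 Suc)
  finally show ?case by simp
qed

context labelled_graph
begin

text \<open>Each cell of \<open>n\<close> consecutive positions holds at most one marker.\<close>

lemma card_marked:
  assumes y: "\<And>i. y i \<in> L ` V"
  shows "card {j \<in> {0..<int B}. marked n N rk y j} \<le> B div n + 1"
proof -
  let ?M = "{j \<in> {0..<int B}. marked n N rk y j}"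
  have inj: "win y i N = win y j N" if "rk (win y i N) = rk (win y j N)" for i j
    by (rule inj_onD[OF rk_inj that]) (use y in \<open>auto simp: win_def\<close>)
  have n0: "0 < int n" using n_pos by simp
  have "inj_on (\<lambda>j. j div int n) ?M"
  proof (rule inj_onI, rule ccontr)
    fix i j assume ij: "i \<in> ?M" "j \<in> ?M" "i div int n = j div int n" "i \<noteq> j"
    have "\<bar>i - j\<bar> < int n"
    proof -
      have "i = i div int n * int n + i mod int n" "j = j div int n * int n + j mod int n" by simp_all
      moreover have "0 \<le> i mod int n" "i mod int n < int n" "0 \<le> j mod int n" "j mod int n < int n"
        using n0 by simp_all
      ultimately show ?thesis using ij(3) by (smt (verit))
    qed
    then show False
      using marked_separated[of n N rk y i j] marked_separated[of n N rk y j i] inj ij by (auto simp: abs_if split: if_splits)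
  qed
  moreover have "(\<lambda>j. j div int n) ` ?M \<subseteq> {0..int (B div n)}"
    using n0 by (auto simp: pos_imp_zdiv_nonneg_iff zdiv_int intro!: zdiv_mono1)
  ultimately have "card ?M \<le> card {0..int (B div n)}"
    by (intro card_inj_on_le) auto
  then show ?thesis by simp
qed

text \<open>If a vertex repeats at two positions congruent modulo \<open>p * m\<close>, the walk
  keeps its class at the congruent positions in between. So a change is determined by its residue
  and the vertex one stretch earlier; the additional value \<open>None\<close> stands for the start
  of the run.\<close>

lemma card_class_changes:
  assumes s: "s \<in> P" and y: "\<And>t. 0 \<le> t \<Longrightarrow> t < int B + int N \<Longrightarrow> L (s t) = y t"
    and N: "B + 2 * n \<le> N"
  defines "J \<equiv> {j \<in> {0..<int B}. is_per n N y j}"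
  defines "q \<equiv> (\<lambda>j. int (min_per N y j * m))"
  defines "C \<equiv> {j \<in> J. \<not> (j - q j \<in> J \<and> block y (j - q j) (s (j - q j)) = block y j (s j))}"
  shows "card C \<le> n * m * (card V + 1)"
proof (cases "J = {}")
  case False
  have finJ: "finite J" unfolding J_def by (rule finite_subset[of _ "{0..<int B}"]) auto
  define a b where "a = Min J" and "b = Max J"
  have ab: "a \<in> J" "b \<in> J" using finJ False by (auto simp: a_def b_def)
  have bounds: "a \<le> j" "j \<le> b" if "j \<in> J" for j using that finJ by (auto simp: a_def b_def)
  have range: "0 \<le> a" "b < int B" "a \<le> b" using ab bounds by (auto simp: J_def)
  have per_ab: "is_per n N y a" "is_per n N y b" using ab by (auto simp: J_def)
  \<comment> \<open>All windows starting in the block overlap in \<open>2 * n\<close> letters, so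
    its periodic positions form a single run with one period.\<close>
  have len: "b - a + 2 * int n \<le> int N" using range N by linarith
  have per: "is_per n N y t" if "a \<le> t" "t \<le> b" for t
    by (rule per_run(3)[OF per_ab range(3) len that])
  have J: "j \<in> J" if "a \<le> j" "j \<le> b" for j using per[OF that] that range by (auto simp: J_def)
  define p where "p = min_per N y a"
  have p: "0 < p" "p < n" using min_per(1,2)[OF per_ab(1)] by (auto simp: p_def)
  have run: "periodic_on y a (b + int N) (int p)"
    unfolding p_def by (rule per_run(1)[OF per_ab range(3) len])
  have minp: "min_per N y t = p" if "a \<le> t" "t \<le> b" for t
    unfolding p_def by (rule per_run(2)[OF per_ab(1) per[OF that]]) (use that len in auto)
  obtain y' where y': "\<forall>t. y' (t + int p) = y' t" "\<And>t. a \<le> t \<Longrightarrow> t < b + int N \<Longrightarrow> y' t = y t"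
    and E: "\<And>t. a \<le> t \<Longrightarrow> t \<le> b \<Longrightarrow> conn G L y t (min_per N y t * m) = conn G L y' t (p * m)"
    using run_periodic_continuation[OF per range(3) run minp] by blast
  let ?q = "p * m"
  let ?E = "\<lambda>t. conn G L y' t ?q"
  have q0: "0 < int ?q" using p m_pos by simp
  have q: "q j = int ?q" if "j \<in> J" for j using minp bounds[OF that] by (simp add: q_def)
  have block: "block y t v = class_of (?E t) v" if "a \<le> t" "t \<le> b" for t v
    using per[OF that] E[OF that] marked_not_per[of n N rk y t] by (auto simp: block_def)
  have lab: "L (s t) = y' t" if "a \<le> t" "t < b + int N" for t
    using y[of t] y'(2)[OF that] that range by auto
  have jq: "conn G L y' (j + int (?q * i)) k = conn G L y' j k" for j k i
    using conn_period[OF y'(1), of G L j "m * i" k] by (simp add: mult.assoc)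
  have comp: "?E t O ?E t = ?E t" for t
    using conn_idempotent[OF y'(1) G_subset p(1) idem, of 2 L t] conn_add[of G L y' t ?q ?q]
      conn_period[OF y'(1), of G L t m ?q] by (simp add: mult_2_right)
  define key where "key j = (j mod int ?q, if j - int ?q \<in> J then Some (s (j - int ?q)) else None)" for j
  have "inj_on key C"
  proof (rule linorder_inj_onI)
    fix i j assume ij: "i < j" "i \<in> C" "j \<in> C"
    show "key i \<noteq> key j"
    proof
      assume eq: "key i = key j"
      have iJ: "i \<in> J" "j \<in> J" using ij by (auto simp: C_def)
      have "i mod int ?q = j mod int ?q" using eq by (simp add: key_def)
      then have "int ?q dvd j - i" by (metis mod_eq_dvd_iff)
      then obtain k0 where k0: "j - i = int ?q * k0" by blast
      then have "0 < k0" using ij(1) q0 by (metis diff_gt_0_iff_gt zero_less_mult_pos)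
      then obtain k where k: "k0 = int k + 1" by (metis add.commute zero_less_imp_eq_int zless_iff_Suc_zadd of_nat_0 add_0 of_nat_Suc)
      have jk: "j = i + int ?q + int (?q * k)" using k0 unfolding k by (simp add: algebra_simps)
      have qk: "0 \<le> int (?q * k)" by simp
      have "j - int ?q \<in> J" by (rule J) (use jk qk bounds[OF iJ(1)] bounds[OF iJ(2)] q0 in linarith)+
      then have si: "i - int ?q \<in> J" "s (i - int ?q) = s (j - int ?q)" using eq by (auto simp: key_def split: if_splits)
      \<comment> \<open>From \<open>?i\<close> the walk goes on to \<open>i\<close> and to
        \<open>j - int ?q\<close>, where it shows the vertex of \<open>?i\<close> again. Thus the
        class at \<open>i\<close> equals the class one stretch before, and \<open>i\<close> is no
        change.\<close>
      let ?i = "i - int ?q"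
      have "(s ?i, s (?i + int ?q)) \<in> conn G L y' ?i ?q"
        by (rule conn_vertex_shift[OF s]) (rule lab; use bounds[OF si(1)] bounds[OF iJ(1)] in linarith)
      then have 1: "(s ?i, s i) \<in> ?E i" using jq[of ?i 1 ?q] by simp
      have "(s i, s (i + int (?q * k))) \<in> conn G L y' i (?q * k)"
        by (rule conn_vertex_shift[OF s]) (rule lab; use jk q0 bounds[OF iJ(1)] bounds[OF iJ(2)] in linarith)
      moreover have "i + int (?q * k) = j - int ?q" using jk by simp
      ultimately have 2: "(s i, s ?i) \<in> conn G L y' i (?q * k)" using si(2) by simp
      have 3: "s i = s ?i \<or> (s i, s ?i) \<in> ?E i"
        using 2 conn_idempotent[OF y'(1) G_subset p(1) idem, of k L i] conn_0[of G L y' i]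
        by (cases "k = 0") auto
      have "class_of (?E i) (s ?i) = class_of (?E i) (s i)"
        using 3 class_of_eqI[OF comp 1] by auto
      then have "block y ?i (s ?i) = block y i (s i)"
        using block[of ?i] block[of i] bounds[OF si(1)] bounds[OF iJ(1)] jq[of ?i 1 ?q] by simp
      then show False using ij(2) si(1) q[OF iJ(1)] by (simp add: C_def)
    qed
  qed auto
  moreover have "key ` C \<subseteq> {0..<int ?q} \<times> insert None (Some ` V)"
    using q0 P_vertex[OF s] by (auto simp: key_def)
  ultimately have "card C \<le> card ({0..<int ?q} \<times> insert None (Some ` V))"
    using finite_V by (intro card_inj_on_le) auto
  also have "\<dots> = ?q * (card V + 1)"
    using finite_V by (simp add: card_cartesian_product card_image del: of_nat_mult)
  also have "\<dots> \<le> n * m * (card V + 1)" using p by (intro mult_le_mono) auto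
  finally show ?thesis .
qed (simp add: C_def)

text \<open>Given the labels, a block is encoded by its vertices at markers and its class changes.
  The number \<open>d\<close> of changes does not depend on \<open>B\<close>, so they contribute
  only \<open>d * ln B / B\<close> up to constants.\<close>

lemma entropy_block_code:
  assumes B: "1 \<le> B" "B + 2 * n \<le> N"
  defines "d \<equiv> n * m * (card V + 1)"
  shows "entropy (block_code ` P) \<le> entropy ((\<lambda>s i. L (s i)) ` P) +
    ln (real (card V ^ (B div n + 1) * (B * 2 ^ card V + 1) ^ d)) / real B"
proof (rule entropy_fibre_bound[OF shift_space_P local_code_letterwise local_code_block_code
      shift_space_letterwise[OF shift_space_P] shift_space_block_code B(1), where c = "rad"])
  fix s0 assume s0: "s0 \<in> P"
  define y where "y = (\<lambda>j. L (s0 j))"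
  have yV: "y i \<in> L ` V" for i using P_vertex[OF s0] by (simp add: y_def)
  let ?R = "{s. s \<in> P \<and> (\<forall>j. - int rad \<le> j \<and> j < int (B + rad) \<longrightarrow> L (s j) = y j)}"
  let ?I = "{0..<int B}"
  let ?M = "{j \<in> ?I. marked n N rk y j}"
  define J where "J = {j \<in> ?I. is_per n N y j}"
  define q where "q j = int (min_per N y j * m)" for j
  define kap where "kap s = restrict (\<lambda>j. block y j (s j)) ?I" for s
  \<comment> \<open>The entire record of the periodic positions: the class is stored only where it
    differs from the class \<open>q j\<close> earlier or where no such predecessor exists in
    \<open>J\<close>.\<close>
  define D where "D \<kappa> = (\<lambda>j. (j, \<kappa> j)) ` {j \<in> J. \<not> (j - q j \<in> J \<and> \<kappa> (j - q j) = \<kappa> j)}"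
    for \<kappa> :: "int \<Rightarrow> 'v set"
  let ?code = "\<lambda>\<kappa>. (restrict \<kappa> ?M, D \<kappa>)"
  let ?codes = "(?M \<rightarrow>\<^sub>E (\<lambda>v. {v}) ` V) \<times> {S. S \<subseteq> ?I \<times> Pow V \<and> card S \<le> d}"
  have JI: "J \<subseteq> ?I" by (auto simp: J_def)
  have finM: "finite ?M" by (rule finite_subset[of _ ?I]) auto
  have fin_codes: "finite ?codes"
    using finite_V finM by (intro finite_SigmaI finite_PiE) auto
  have codes: "?code ` kap ` ?R \<subseteq> ?codes"
  proof
    fix c assume "c \<in> ?code ` kap ` ?R"
    then obtain s where s: "s \<in> P" "\<forall>j. - int rad \<le> j \<and> j < int (B + rad) \<longrightarrow> L (s j) = y j"
      and c: "c = ?code (kap s)" by blast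
    have C: "card {j \<in> J. \<not> (j - q j \<in> J \<and> block y (j - q j) (s (j - q j)) = block y j (s j))} \<le> d"
      unfolding J_def q_def d_def
      by (rule card_class_changes[OF s(1) _ B(2)]) (use s(2) in \<open>auto simp: rad_def simp del: of_nat_mult\<close>)
    have D: "D (kap s) = (\<lambda>j. (j, block y j (s j))) `
        {j \<in> J. \<not> (j - q j \<in> J \<and> block y (j - q j) (s (j - q j)) = block y j (s j))}"
    proof -
      have "kap s j = block y j (s j)" if "j \<in> J" for j using that JI by (auto simp: kap_def)
      then show ?thesis unfolding D_def by (intro image_cong) auto
    qed
    have "card (D (kap s)) \<le> d" unfolding D
      by (rule order_trans[OF card_image_le C]) (rule finite_subset[of _ ?I], use JI in auto)
    moreover have "D (kap s) \<subseteq> ?I \<times> Pow V" unfolding D using JI block_subset[OF s(1)] by auto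
    moreover have "restrict (kap s) ?M \<in> ?M \<rightarrow>\<^sub>E (\<lambda>v. {v}) ` V"
    proof (rule restrict_PiE_iff[THEN iffD2], intro ballI)
      fix j assume "j \<in> ?M"
      then have "kap s j = {s j}" by (simp add: kap_def block_def)
      then show "kap s j \<in> (\<lambda>v. {v}) ` V" using P_vertex[OF s(1)] by simp
    qed
    ultimately show "c \<in> ?codes" unfolding c by blast
  qed
  have inj: "inj_on ?code (kap ` ?R)"
  proof (rule inj_onI, clarify)
    fix s s' assume s: "s \<in> P" and s': "s' \<in> P"
      and M: "restrict (kap s) ?M = restrict (kap s') ?M" and D: "D (kap s) = D (kap s')"
    \<comment> \<open>Decoding from left to right: a class is either listed in \<open>D\<close> or
      copied from the periodic position \<open>q j\<close> earlier.\<close>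
    have per: "kap s j = kap s' j" if "j \<in> J" for j
      using that
    proof (induction "nat j" arbitrary: j rule: less_induct)
      case less
      have j: "0 \<le> j" and pj: "is_per n N y j" using less.prems by (auto simp: J_def)
      have "0 < q j" unfolding q_def using min_per_mult_le(1)[OF pj] by (simp only: of_nat_0_less_iff)
      have IH: "kap s (j - q j) = kap s' (j - q j)" if "j - q j \<in> J"
        by (rule less.hyps[OF _ that]) (use that \<open>0 < q j\<close> JI in auto)
      show ?case
      proof (cases "j \<in> fst ` D (kap s)")
        case True
        then have "(j, kap s j) \<in> D (kap s)" by (auto simp: D_def)
        then show ?thesis unfolding D by (auto simp: D_def)
      next
        case False
        then have 1: "j - q j \<in> J \<and> kap s (j - q j) = kap s j" using less.prems by (force simp: D_def)
        have "j \<notin> fst ` D (kap s')" using False D by simp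
        then have 2: "j - q j \<in> J \<and> kap s' (j - q j) = kap s' j" using less.prems by (force simp: D_def)
        show ?thesis using 1 2 IH by simp
      qed
    qed
    show "kap s = kap s'"
    proof
      fix j
      consider "j \<notin> ?I" | "j \<in> ?M" | "j \<in> J" | "j \<in> ?I" "j \<notin> ?M" "j \<notin> J" by blast
      then show "kap s j = kap s' j"
      proof cases
        case 1
        then show ?thesis by (auto simp: kap_def)
      next
        case 2
        then show ?thesis using fun_cong[OF M, of j] by simp
      next
        case 3
        then show ?thesis by (rule per)
      next
        case 4
        then show ?thesis by (auto simp: kap_def J_def block_def)
      qed
    qed
  qed
  have le: "card (kap ` ?R) \<le> card ?codes" by (rule card_inj_on_le[OF inj codes fin_codes])
  have fin: "finite (kap ` ?R)"
    by (rule finite_imageD[OF finite_subset[OF codes fin_codes] inj])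
  have "{win (block_code s) 0 B |s. s \<in> P \<and> (\<forall>j. - int rad \<le> j \<and> j < int (B + rad) \<longrightarrow> L (s j) = L (s0 j))}
      \<subseteq> (\<lambda>\<kappa>. map (\<lambda>k. (y (int k), \<kappa> (int k))) [0..<B]) ` kap ` ?R"
  proof clarify
    fix s assume s: "s \<in> P" "\<forall>j. - int rad \<le> j \<and> j < int (B + rad) \<longrightarrow> L (s j) = L (s0 j)"
    have "block_code s (int k) = (y (int k), kap s (int k))" if k: "k < B" for k
    proof -
      have eq: "L (s j) = y j" if "\<bar>j - int k\<bar> \<le> int rad" for j
        unfolding y_def by (rule s(2)[rule_format]) (use that k in auto)
      have "block (\<lambda>j. L (s j)) (int k) (s (int k)) = block y (int k) (s (int k))"
        by (rule block_cong) (use eq P_vertex[OF s(1)] yV in simp_all)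
      then show ?thesis using eq[of "int k"] k by (simp add: block_code_def kap_def)
    qed
    then have "win (block_code s) 0 B = map (\<lambda>k. (y (int k), kap s (int k))) [0..<B]"
      by (simp add: win_def)
    moreover have "s \<in> ?R" using s by (simp add: y_def)
    ultimately show "win (block_code s) 0 B \<in> (\<lambda>\<kappa>. map (\<lambda>k. (y (int k), \<kappa> (int k))) [0..<B]) ` kap ` ?R"
      by blast
  qed
  from card_mono[OF finite_imageI[OF fin] this]
  have "card {win (block_code s) 0 B |s. s \<in> P \<and> (\<forall>j. - int rad \<le> j \<and> j < int (B + rad) \<longrightarrow> L (s j) = L (s0 j))}
      \<le> card (kap ` ?R)"
    using card_image_le[OF fin] by (rule order_trans)
  also have "\<dots> \<le> card ?codes" by (rule le)
  also have "\<dots> = card (?M \<rightarrow>\<^sub>E (\<lambda>v. {v}) ` V) * card {S. S \<subseteq> ?I \<times> Pow V \<and> card S \<le> d}"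
    by (rule card_cartesian_product)
  also have "\<dots> \<le> card V ^ (B div n + 1) * (B * 2 ^ card V + 1) ^ d"
  proof (rule mult_le_mono)
    have "card (?M \<rightarrow>\<^sub>E (\<lambda>v. {v}) ` V) = card V ^ card ?M"
      using finM by (simp add: card_PiE card_image)
    also have "\<dots> \<le> card V ^ (B div n + 1)"
    proof (rule power_increasing[OF card_marked[OF yV]])
      have "V \<noteq> {}" using P_vertex[OF s0] by blast
      then show "1 \<le> card V" using finite_V by (simp add: Suc_leI card_gt_0_iff)
    qed
    finally show "card (?M \<rightarrow>\<^sub>E (\<lambda>v. {v}) ` V) \<le> card V ^ (B div n + 1)" .
    show "card {S. S \<subseteq> ?I \<times> Pow V \<and> card S \<le> d} \<le> (B * 2 ^ card V + 1) ^ d"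
      using card_bounded_subsets[of "?I \<times> Pow V" d] finite_V
      by (simp add: card_cartesian_product card_Pow)
  qed
  finally show "card {win (block_code s) 0 B |s. s \<in> P \<and> (\<forall>j. - int rad \<le> j \<and> j < int (B + rad) \<longrightarrow> L (s j) = L (s0 j))}
      \<le> card V ^ (B div n + 1) * (B * 2 ^ card V + 1) ^ d" .
qed

end

subsection \<open>Intermediate shifts of finite type\<close>

lemma block_parameters_limit:
  fixes a c d n :: real
  assumes "0 < n" "0 < c"
  shows "(\<lambda>B::nat. ((real B / n + 1) * a + d * ln (real B * c + 1)) / real B) \<longlonglongrightarrow> a / n"
  using assms by real_asymp (simp add: field_simps)

text \<open>The order of choices matters: \<open>n\<close> makes the cost
  \<open>ln (card V) / n\<close> of the markers small, \<open>m\<close> depends on \<open>V\<close>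
  only, so \<open>d\<close> is fixed before \<open>B\<close>, and a large \<open>B\<close> makes the
  cost of class changes negligible. \<open>N\<close> and \<open>H\<close> come last and do not enter
  the estimate.\<close>

lemma vertex_shift_finite_type_cover:
  fixes L :: "'v \<Rightarrow> 'b"
  assumes V: "finite V" and G: "G \<subseteq> V \<times> V" and ne: "vertex_shift G \<noteq> {}" and e: "0 < (e::real)"
  obtains \<psi> :: "(int \<Rightarrow> 'v) \<Rightarrow> int \<Rightarrow> 'b \<times> 'v set" and c
  where "local_code (vertex_shift G) c \<psi>" "\<And>s i. s \<in> vertex_shift G \<Longrightarrow> \<psi> s i \<in> L ` V \<times> Pow V"
    "\<And>s i. s \<in> vertex_shift G \<Longrightarrow> fst (\<psi> s i) = L (s i)" "finite_type (\<psi> ` vertex_shift G)"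
    "entropy (\<psi> ` vertex_shift G) \<le> entropy ((\<lambda>s i. L (s i)) ` vertex_shift G) + e"
proof -
  obtain s0 where "s0 \<in> vertex_shift G" using ne by blast
  then have "s0 0 \<in> V" using G by (auto simp: vertex_shift_def)
  then have v: "1 \<le> card V" using V by (metis One_nat_def Suc_leI card_gt_0_iff empty_iff)
  let ?a = "ln (real (card V))"
  obtain n0 :: nat where n0: "?a / e < real n0" using reals_Archimedean2 by blast
  define n where "n = Suc n0"
  have n: "1 \<le> n" "?a / real n < e"
  proof -
    have "?a / e < real n" using n0 by (simp add: n_def)
    then show "?a / real n < e" using e by (simp add: n_def field_simps)
  qed (simp add: n_def)
  obtain m where m: "m \<ge> 1" "\<And>T. T \<subseteq> V \<times> V \<Longrightarrow> (T ^^ m) O (T ^^ m) = T ^^ m"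
    using relpow_idempotent_exponent[OF V] by blast
  define d where "d = n * m * (card V + 1)"
  let ?b = "\<lambda>B::nat. ((real B / real n + 1) * ?a + real d * ln (real B * 2 ^ card V + 1)) / real B"
  have "?b \<longlonglongrightarrow> ?a / real n" by (rule block_parameters_limit) (use n in auto)
  then have "\<forall>\<^sub>F B in sequentially. ?b B < e" using n(2) by (rule order_tendstoD(2))
  then have "\<forall>\<^sub>F B in sequentially. ?b B < e \<and> 1 \<le> B"
    by (rule eventually_conj[OF _ eventually_ge_at_top])
  then obtain B where B: "?b B < e" "1 \<le> B"
    using eventually_happens'[OF sequentially_bot] by blast
  define N where "N = B + 2 * n + n * m + 1"
  let ?W = "{w. set w \<subseteq> L ` V \<and> length w = N}"
  have finW: "finite ?W" by (rule finite_lists_length_eq) (use V in simp)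
  obtain rk :: "'b list \<Rightarrow> nat" where rk: "inj_on rk ?W"
    using finite_imp_inj_to_nat_seg[OF finW] by blast
  obtain H where H: "\<And>w. w \<in> ?W \<Longrightarrow> rk w \<le> H"
    using finite_imageI[OF finW, of rk] unfolding finite_nat_set_iff_bounded_le by blast
  interpret labelled_graph V G L n N m H rk
    by unfold_locales (use V G n m rk H ne in \<open>auto simp: N_def\<close>)
  have "ln (real (card V ^ (B div n + 1) * (B * 2 ^ card V + 1) ^ d)) / real B \<le> ?b B"
  proof (rule divide_right_mono)
    have "0 \<le> ?a" using v by simp
    have "ln (real (card V ^ (B div n + 1) * (B * 2 ^ card V + 1) ^ d)) =
        ln (real (card V) ^ (B div n + 1)) + ln ((real B * 2 ^ card V + 1) ^ d)"
    proof -
      have "real (card V) ^ (B div n + 1) > 0" using v by simp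
      moreover have "(real B * 2 ^ card V + 1) ^ d > 0"
        by (intro zero_less_power add_nonneg_pos mult_nonneg_nonneg) auto
      moreover have "real (card V ^ (B div n + 1) * (B * 2 ^ card V + 1) ^ d) =
          real (card V) ^ (B div n + 1) * (real B * 2 ^ card V + 1) ^ d" by (simp add: add_ac)
      ultimately show ?thesis by (simp only: ln_mult_pos)
    qed
    also have "\<dots> = real (B div n + 1) * ?a + real d * ln (real B * 2 ^ card V + 1)"
      using v by (subst (1 2) ln_realpow) (auto intro!: add_nonneg_pos)
    also have "\<dots> \<le> (real B / real n + 1) * ?a + real d * ln (real B * 2 ^ card V + 1)"
      using of_nat_div_le_of_nat[of B n, where ?'a = real] \<open>0 \<le> ?a\<close>
      by (intro add_right_mono mult_right_mono) auto
    finally show "ln (real (card V ^ (B div n + 1) * (B * 2 ^ card V + 1) ^ d)) \<le>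
        (real B / real n + 1) * ?a + real d * ln (real B * 2 ^ card V + 1)" .
  qed simp
  then have "entropy (block_code ` P) \<le> entropy ((\<lambda>s i. L (s i)) ` P) + e"
    using entropy_block_code[OF B(2)] B(1) by (simp add: N_def d_def)
  then show ?thesis
    using that[OF local_code_block_code block_code_alphabet _ finite_type_block_code]
    by (simp add: block_code_def)
qed

lemma local_code_compose:
  assumes f: "local_code X r f" and g: "local_code (f ` X) c g" and X: "shift_space X"
  shows "local_code X (r + c) (\<lambda>x. g (f x))"
  unfolding local_code_def
proof (intro conjI ballI allI impI)
  fix x k assume "x \<in> X"
  then show "g (f (translate k x)) = translate k (g (f x))"
    using local_code_translate[OF f] local_code_translate[OF g] by simp
next
  fix x x' assume x: "x \<in> X" "x' \<in> X" "\<forall>j. \<bar>j\<bar> \<le> int (r + c) \<longrightarrow> x j = x' j"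
  have "f x i = f x' i" if "\<bar>i\<bar> \<le> int c" for i
    by (rule local_codeD[OF f X x(1,2)], rule x(3)[rule_format]) (use that in auto)
  then show "g (f x) 0 = g (f x') 0"
    using g x(1,2) unfolding local_code_def by blast
qed

lemma win_Suc_overlap: "tl (win x i (Suc n)) = win x (i + 1) n" "butlast (win x i (Suc n)) = win x i n"
  by (simp_all add: list_eq_iff_nth_eq nth_tl nth_butlast algebra_simps)

text \<open>Uses the higher block presentation of \<open>X\<close> as a vertex shift on its words of length
  \<open>2 q + 1\<close>.\<close>

lemma finite_type_between:
  fixes X :: "(int \<Rightarrow> 'a) set" and \<phi> :: "(int \<Rightarrow> 'a) \<Rightarrow> int \<Rightarrow> 'b"
  assumes ft: "finite_type X" and \<phi>: "local_code X r \<phi>" and e: "0 < (e::real)"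
  obtains \<psi> :: "(int \<Rightarrow> 'a) \<Rightarrow> int \<Rightarrow> 'b \<times> 'a list set" and c D
  where "local_code X c \<psi>" "finite D" "\<And>x i. x \<in> X \<Longrightarrow> \<psi> x i \<in> D"
    "\<And>x i. x \<in> X \<Longrightarrow> fst (\<psi> x i) = \<phi> x i" "finite_type (\<psi> ` X)"
    "entropy (\<psi> ` X) \<le> entropy (\<phi> ` X) + e"
proof -
  have X: "shift_space X" using ft by (simp add: finite_type_def)
  obtain M where M: "\<And>N x. M \<le> N \<Longrightarrow> (\<And>i. win x i N \<in> words N X) \<Longrightarrow> x \<in> X"
    using finite_typeE[OF ft] by blast
  \<comment> \<open>A centred window of length \<open>2 * q + 1\<close> then determines the value of
    \<open>\<phi>\<close> at its centre and is long enough to decide membership in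
    \<open>X\<close>.\<close>
  define q where "q = max r M"
  define R where "R = 2 * q"
  define st where "st x = (\<lambda>i. win x (i - int q) (Suc R))" for x :: "int \<Rightarrow> 'a"
  define V where "V = words (Suc R) X"
  define G where "G = {(u, v) \<in> V \<times> V. tl u = butlast v}"
  \<comment> \<open>For \<open>u\<close> in \<open>V\<close> the choice is harmless: all candidates
    agree within distance \<open>r\<close> of the origin.\<close>
  define L where "L u = \<phi> (SOME x. x \<in> X \<and> win x (- int q) (Suc R) = u) 0" for u
  have V: "finite V" unfolding V_def by (rule finite_words[OF X])
  have stV: "st x i \<in> V" if "x \<in> X" for x i
    using win_in_words[OF that] by (simp add: st_def V_def)
  have st_path: "st x \<in> vertex_shift G" if "x \<in> X" for x
    using stV[OF that] by (auto simp: vertex_shift_def G_def st_def win_Suc_overlap algebra_simps)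
  have path_st: "s \<in> st ` X" if s: "s \<in> vertex_shift G" for s
  proof -
    have sV: "s i \<in> V" and ov: "tl (s i) = butlast (s (i + 1))" for i
      using s by (auto simp: vertex_shift_def G_def)
    have len: "length (s i) = Suc R" for i using sV[of i] by (auto simp: V_def words_def)
    \<comment> \<open>Windows start \<open>q\<close> positions to the left of their centre, so the
      letter at \<open>i\<close> heads the window centred at \<open>i + int q\<close>.\<close>
    define x where "x i = hd (s (i + int q))" for i
    have nth: "s i ! k = hd (s (i + int k))" if "k < Suc R" for i k
      using that
    proof (induction k arbitrary: i)
      case 0
      have "s i \<noteq> []" using len[of i] by auto
      then show ?case by (simp add: hd_conv_nth)
    next
      case (Suc k)
      have "s i ! Suc k = tl (s i) ! k" using Suc.prems by (simp add: nth_tl len)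
      also have "\<dots> = s (i + 1) ! k" unfolding ov using Suc.prems by (simp add: nth_butlast len)
      also have "\<dots> = hd (s (i + 1 + int k))" by (rule Suc.IH) (use Suc.prems in simp)
      finally show ?case by (simp add: algebra_simps)
    qed
    have win: "win x (i - int q) (Suc R) = s i" for i
      by (rule nth_equalityI) (auto simp: len nth x_def algebra_simps)
    have "win x i (Suc R) \<in> words (Suc R) X" for i
      using win[of "i + int q"] sV[of "i + int q"] by (simp add: V_def)
    then have "x \<in> X" by (intro M[of "Suc R"]) (auto simp: R_def q_def)
    moreover have "st x = s" using win by (auto simp: st_def)
    ultimately show ?thesis by blast
  qed
  have P: "vertex_shift G = st ` X" using st_path path_st by blast
  have st_local: "local_code X q st"
    unfolding local_code_def
  proof (intro conjI ballI allI impI)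
    fix x k show "st (translate k x) = translate k (st x)"
      by (simp add: st_def) (simp add: translate_def algebra_simps)
  next
    fix x x' :: "int \<Rightarrow> 'a" assume "\<forall>j. \<bar>j\<bar> \<le> int q \<longrightarrow> x j = x' j"
    then show "st x 0 = st x' 0" unfolding st_def by (intro win_eqI) (auto simp: R_def)
  qed
  have L: "L (st x i) = \<phi> x i" if x: "x \<in> X" for x i
  proof -
    let ?u = "st x i" and ?t = "translate i x"
    let ?x = "SOME x. x \<in> X \<and> win x (- int q) (Suc R) = ?u"
    have t: "?t \<in> X \<and> win ?t (- int q) (Suc R) = ?u"
      using shift_spaceD(2)[OF X x] by (simp add: st_def)
    have some: "?x \<in> X \<and> win ?x (- int q) (Suc R) = ?u" 
      by (rule someI[of "\<lambda>x. x \<in> X \<and> win x (- int q) (Suc R) = ?u", OF t])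
    then have "win ?x (- int q) (Suc R) = win ?t (- int q) (Suc R)" using t by simp
    from win_eqD[OF this] have "?x j = ?t j" if "\<bar>j\<bar> \<le> int r" for j
      using that by (simp add: R_def q_def)
    then have "\<phi> ?x 0 = \<phi> ?t 0"
      using \<phi> some t unfolding local_code_def by blast
    then show ?thesis
      unfolding L_def local_code_translate[OF \<phi> x] by (simp add: translate_apply)
  qed
  have GV: "G \<subseteq> V \<times> V" by (auto simp: G_def)
  have ne: "vertex_shift G \<noteq> {}" unfolding P using shift_spaceD(1)[OF X] by simp
  obtain \<psi> :: "(int \<Rightarrow> 'a list) \<Rightarrow> int \<Rightarrow> 'b \<times> 'a list set" and c where \<psi>:
    "local_code (vertex_shift G) c \<psi>" "\<And>s i. s \<in> vertex_shift G \<Longrightarrow> \<psi> s i \<in> L ` V \<times> Pow V"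
    "\<And>s i. s \<in> vertex_shift G \<Longrightarrow> fst (\<psi> s i) = L (s i)" "finite_type (\<psi> ` vertex_shift G)"
    "entropy (\<psi> ` vertex_shift G) \<le> entropy ((\<lambda>s i. L (s i)) ` vertex_shift G) + e"
    by (rule vertex_shift_finite_type_cover[OF V GV ne e, of L]) (rule that)
  show ?thesis
  proof (rule that[of "q + c" "\<lambda>x. \<psi> (st x)" "L ` V \<times> Pow V"])
    show "local_code X (q + c) (\<lambda>x. \<psi> (st x))"
      by (rule local_code_compose[OF st_local _ X]) (use \<psi>(1) P in simp)
    show "finite (L ` V \<times> Pow V)" using V by simp
    have im: "(\<lambda>x. \<psi> (st x)) ` X = \<psi> ` vertex_shift G" unfolding P by (simp add: image_image)
    show "finite_type ((\<lambda>x. \<psi> (st x)) ` X)" unfolding im by (rule \<psi>(4))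
    have "(\<lambda>s i. L (s i)) ` vertex_shift G = \<phi> ` X"
      unfolding P image_image using L by (intro image_cong) auto
    then show "entropy ((\<lambda>x. \<psi> (st x)) ` X) \<le> entropy (\<phi> ` X) + e"
      unfolding im using \<psi>(5) by simp
  qed (use \<psi>(2,3) st_path L in auto)
qed

lemma intermediate_entropies_bounds:
  fixes X :: "(int \<Rightarrow> 'a) set" and Y :: "(int \<Rightarrow> 'b) set"
  shows "intermediate_entropies X Y \<phi> \<subseteq> {entropy Y..entropy X}"
proof
  fix h assume "h \<in> intermediate_entropies X Y \<phi>"
  then obtain \<phi>1 :: "(int \<Rightarrow> 'a) \<Rightarrow> int \<Rightarrow> nat" and \<phi>2 :: "(int \<Rightarrow> nat) \<Rightarrow> int \<Rightarrow> 'b" where h: "h = entropy (\<phi>1 ` X)"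
    and f: "factor_code X (\<phi>1 ` X) \<phi>1" "factor_code (\<phi>1 ` X) Y \<phi>2"
    unfolding intermediate_entropies_def decomposes_def by blast
  show "h \<in> {entropy Y..entropy X}"
    using entropy_factor_le[OF f(1)] entropy_factor_le[OF f(2)] by (simp add: h)
qed

lemma intermediate_entropies_ft_subset:
  "intermediate_entropies_ft X Y \<phi> \<subseteq> intermediate_entropies X Y \<phi>"
  unfolding intermediate_entropies_def intermediate_entropies_ft_def by blast

theorem theorem1p1:
  fixes X :: "(int \<Rightarrow> 'a) set" and Y :: "(int \<Rightarrow> 'b) set"
    and \<phi> :: "(int \<Rightarrow> 'a) \<Rightarrow> (int \<Rightarrow> 'b)"
  assumes "sofic X" and "sofic Y" and "factor_code X Y \<phi>"
  shows "dense_subset (intermediate_entropies X Y \<phi>) {entropy Y..entropy X} \<and>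
         (finite_type X \<longrightarrow>
            dense_subset (intermediate_entropies_ft X Y \<phi>) {entropy Y..entropy X})"
proof -
  have X: "shift_space X" and Y: "shift_space Y" and im: "\<phi> ` X = Y"
    using assms(3) by (auto simp: factor_code_def code_def)
  obtain r where \<phi>: "local_code X r \<phi>" using factor_code_imp_local[OF assms(3)] by blast
  obtain D where D: "finite D" "\<And>y i. y \<in> Y \<Longrightarrow> y i \<in> D" using alphabet_obtain[OF Y] by blast
  have D0: "\<phi> x 0 \<in> D" if "x \<in> X" for x using D(2) im that by blast
  have closeI: "t \<in> closure S" if near: "\<And>e. 0 < e \<Longrightarrow> \<exists>s\<in>S. \<bar>s - t\<bar> \<le> e" for t :: real and S
    unfolding closure_approachable
  proof (intro allI impI)
    fix e :: real assume "0 < e"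
    then obtain s where "s \<in> S" "\<bar>s - t\<bar> \<le> e / 2" using near[of "e / 2"] by auto
    then show "\<exists>s\<in>S. dist s t < e" using \<open>0 < e\<close> by (intro bexI[of _ s]) (auto simp: dist_real_def)
  qed
  have reveal: "\<exists>n C. \<bar>entropy (reveal n C \<phi> ` X) - t\<bar> \<le> e"
    if "t \<in> {entropy Y..entropy X}" "0 < e" for t e
    using entropy_reveal_dense[OF X \<phi> D(1) D0, of t e] that im by (metis atLeastAtMost_iff)
  have "t \<in> closure (intermediate_entropies X Y \<phi>)" if t: "t \<in> {entropy Y..entropy X}" for t
  proof (rule closeI)
    fix e :: real assume "0 < e"
    then obtain n C where nC: "\<bar>entropy (reveal n C \<phi> ` X) - t\<bar> \<le> e" using reveal t by blast
    have "finite (D \<times> insert None (Some ` words n X))" using D(1) finite_words[OF X] by simp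
    moreover have "reveal n C \<phi> x 0 \<in> D \<times> insert None (Some ` words n X)" if "x \<in> X" for x
      by (rule reveal_alphabet) (use that D0 in auto)
    moreover have "\<phi> x 0 = fst (reveal n C \<phi> x 0)" for x by (simp add: reveal_def)
    ultimately have "entropy (reveal n C \<phi> ` X) \<in> intermediate_entropies X Y \<phi>"
      by (rule decomposes_letterwise(1)[OF assms(3) local_code_reveal[OF \<phi>]])
    then show "\<exists>s\<in>intermediate_entropies X Y \<phi>. \<bar>s - t\<bar> \<le> e" using nC by blast
  qed
  moreover have "t \<in> closure (intermediate_entropies_ft X Y \<phi>)"
    if ft: "finite_type X" and t: "t \<in> {entropy Y..entropy X}" for t
  proof (rule closeI)
    fix e :: real assume e: "0 < e"
    \<comment> \<open>Half of the error is spent on revealing words, the other half on the shift of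
      finite type inserted above the revealed factor.\<close>
    then obtain n C where nC: "\<bar>entropy (reveal n C \<phi> ` X) - t\<bar> \<le> e / 2" using reveal[OF t, of "e / 2"] by auto
    obtain \<psi> :: "(int \<Rightarrow> 'a) \<Rightarrow> int \<Rightarrow> ('b \<times> 'a list option) \<times> 'a list set" and c E where \<psi>:
      "local_code X c \<psi>" "finite E" "\<And>x i. x \<in> X \<Longrightarrow> \<psi> x i \<in> E"
      "\<And>x i. x \<in> X \<Longrightarrow> fst (\<psi> x i) = reveal n C \<phi> x i" "finite_type (\<psi> ` X)"
      "entropy (\<psi> ` X) \<le> entropy (reveal n C \<phi> ` X) + e / 2"
      by (rule finite_type_between[OF ft local_code_reveal[OF \<phi>] half_gt_zero[OF e], of n C]) (rule that)
    have "(\<lambda>z i. fst (z i)) ` \<psi> ` X = reveal n C \<phi> ` X"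
      unfolding image_image using \<psi>(4) by (intro image_cong) auto
    then have "entropy (reveal n C \<phi> ` X) \<le> entropy (\<psi> ` X)"
      using entropy_letterwise_le[of "\<psi> ` X" fst] \<psi>(5) by (simp add: finite_type_def)
    then have "\<bar>entropy (\<psi> ` X) - t\<bar> \<le> e" using nC \<psi>(6) by linarith
    \<comment> \<open>The inner \<open>fst\<close> forgets the recorded set of vertices, the outer
      one the revealed word.\<close>
    moreover have "entropy (\<psi> ` X) \<in> intermediate_entropies_ft X Y \<phi>"
      by (rule decomposes_letterwise(2)[OF assms(3) \<psi>(1,2,3) _ \<psi>(5), where \<pi> = "\<lambda>v. fst (fst v)"])
        (auto simp: \<psi>(4) reveal_def)
    ultimately show "\<exists>s\<in>intermediate_entropies_ft X Y \<phi>. \<bar>s - t\<bar> \<le> e" by blast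
  qed
  ultimately show ?thesis
    unfolding dense_subset_def
    using intermediate_entropies_bounds intermediate_entropies_ft_subset by blast
qed

end
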